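(* Let $\varphi,\psi:\Sigma\to\mathbb{R}$ be Hölder continuous with $\psi>0$ and let $\mathcal{C}\subset\Sigma^*$ be finitely irreducible and representable by loops. Then $(\psi,\varphi,\mathcal{C})$ satisfies the exhausting principle.
   Context: Markov shift: $I\subset\mathbb{N}$ is an alphabet (finite or infinite), $A\in\{0,1\}^{I\times I}$ an incidence matrix, $\Sigma=\{\omega\in I^{\mathbb{N}}: A_{\omega_i\omega_{i+1}}=1\ \forall i\in\mathbb N\}$, $\sigma$ the left shift. $\Sigma^*$ is the set of all finite non-empty words over $I$ whose consecutive letters $ij$ satisfy $A_{ij}=1$; $|\omega|$ is the length of $\omega\in\Sigma^*$; $[\omega]=\{\tau\in\Sigma:\tau\text{ begins with }\omega\}$. $\Sigma$ is topologized by the metrics $d_\alpha(\omega,\omega')=e^{-\alpha|\omega\wedge\omega'|}$, $\alpha>0$, where $\omega\wedge\omega'$ is the longest common initial block. Hölder continuity: $f:\Sigma\to\mathbb{R}$ is Hölder continuous if there are $\alpha>0$ and $V\ge0$ with $|f(\omega)-f(\omega')|\le V d_\alpha(\omega,\omega')$ for all $\omega,\omega'\in\Sigma$ with $|\omega\wedge\omega'|\ge1$. Induced pressure: $$\mathcal{P}_\psi(\varphi,\mathcal{C})=\limsup_{T\to\infty}\frac1T\log\sum_{\omega\in\mathcal{C},\ T-\eta<S_\omega\psi\le T}\exp S_\omega\varphi\in[-\infty,\infty],\qquad S_\omega f=\sup_{\tau\in[\omega]}\sum_{k=0}^{|\omega|-1}f(\sigma^k\tau),$$ where $\eta>0$ is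 any fixed number (the value does not depend on $\eta$), and $\log 0=-\infty$, $\sup\emptyset=-\infty$. For a $\sigma$-invariant $K\subset\Sigma$, $K^*=\{\omega\in\Sigma^*:[\omega]\cap K\ne\emptyset\}$ and $\mathcal{P}_{\psi,K}(\varphi,\mathcal{C})=\mathcal{P}_{\psi|_K}(\varphi|_K,\mathcal{C}\cap K^* )$, where in the latter the suprema in $S_\omega$ are over $[\omega]\cap K$. The exhausting principle holds for $(\psi,\varphi,\mathcal{C})$ if there is a sequence $(K_n)$ of compact $\sigma$-invariant subsets of $\Sigma$ with $\lim_{n\to\infty}\mathcal{P}_{\psi,K_n}(\varphi,\mathcal{C})=\mathcal{P}_\psi(\varphi,\mathcal{C})$. $\mathcal{C}$ is representable by loops if (i) $\omega_1,\omega_2\in\mathcal{C}$ and $\omega_1\omega_2\in\Sigma^*$ imply $\omega_1\omega_2\in\mathcal{C}$, and (ii) $\omega_1\omega_2\in\mathcal{C}$ and $\omega_2\omega_3\in\mathcal{C}$ (non-empty words $\omega_1,\omega_2,\omega_3$) imply $\omega_2\in\mathcal{C}$. $\mathcal{C}$ is finitely irreducible if there is a finite set $\Lambda\subset\Sigma^*$ such that for all $C_1,C_2\in\mathcal{C}$ there is $D\in\Lambda\cup\{\emptyset\}$ ($\emptyset$ the empty word) with $C_1DC_2\in\mathcal{C}$. *)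

theory Defs
  imports "HOL-Analysis.Analysis"
begin

definition shift :: "(nat \<Rightarrow> nat) \<Rightarrow> nat \<Rightarrow> nat" where
  "shift \<tau> = (\<lambda>n. \<tau> (Suc n))"

definition shift_space :: "nat set \<Rightarrow> (nat \<Rightarrow> nat \<Rightarrow> nat) \<Rightarrow> (nat \<Rightarrow> nat) set" where
  "shift_space I A = {\<omega>. \<forall>i. \<omega> i \<in> I \<and> A (\<omega> i) (\<omega> (Suc i)) = 1}"

text \<open>Admissibility of a finite word concerns its consecutive letters only; the word need not
  extend to a point of the shift space.\<close>

definition words :: "nat set \<Rightarrow> (nat \<Rightarrow> nat \<Rightarrow> nat) \<Rightarrow> nat list set" where
  "words I A = {\<omega>. \<omega> \<noteq> [] \<and> set \<omega> \<subseteq> I \<and>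
     (\<forall>i. Suc i < length \<omega> \<longrightarrow> A (\<omega> ! i) (\<omega> ! Suc i) = 1)}"

definition cylinder :: "(nat \<Rightarrow> nat) set \<Rightarrow> nat list \<Rightarrow> (nat \<Rightarrow> nat) set" where
  "cylinder X \<omega> = {\<tau> \<in> X. \<forall>i < length \<omega>. \<tau> i = \<omega> ! i}"

text \<open>Length of the longest common initial block; it is \<open>\<infinity>\<close> exactly for equal sequences.\<close>

definition common_length :: "(nat \<Rightarrow> nat) \<Rightarrow> (nat \<Rightarrow> nat) \<Rightarrow> enat" where
  "common_length \<omega> \<omega>' = (SUP n \<in> {n. \<forall>i<n. \<omega> i = \<omega>' i}. enat n)"

definition shift_dist :: "real \<Rightarrow> (nat \<Rightarrow> nat) \<Rightarrow> (nat \<Rightarrow> nat) \<Rightarrow> real" where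
  "shift_dist \<alpha> \<omega> \<omega>' =
     (case common_length \<omega> \<omega>' of enat n \<Rightarrow> exp (- \<alpha> * real n) | \<infinity> \<Rightarrow> 0)"

text \<open>The metrics with different \<open>\<alpha> > 0\<close> induce the same topology, see
  \<open>mtopology_shift_dist\<close> below; we use \<open>\<alpha> = 1\<close>.\<close>

definition shift_topology :: "nat set \<Rightarrow> (nat \<Rightarrow> nat \<Rightarrow> nat) \<Rightarrow> (nat \<Rightarrow> nat) topology" where
  "shift_topology I A = Metric_space.mtopology (shift_space I A) (shift_dist 1)"

definition Hoelder_continuous :: "(nat \<Rightarrow> nat) set \<Rightarrow> ((nat \<Rightarrow> nat) \<Rightarrow> real) \<Rightarrow> bool" where
  "Hoelder_continuous X f \<longleftrightarrow> (\<exists>\<alpha>>0. \<exists>V\<ge>0. \<forall>\<omega>\<in>X. \<forall>\<omega>'\<in>X.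
     common_length \<omega> \<omega>' \<ge> 1 \<longrightarrow> \<bar>f \<omega> - f \<omega>'\<bar> \<le> V * shift_dist \<alpha> \<omega> \<omega>')"

text \<open>The extended reals make the supremum over an empty cylinder equal to \<open>-\<infinity>\<close>.\<close>

definition birkhoff_sup ::
    "(nat \<Rightarrow> nat) set \<Rightarrow> ((nat \<Rightarrow> nat) \<Rightarrow> real) \<Rightarrow> nat list \<Rightarrow> ereal" where
  "birkhoff_sup X f \<omega> = (SUP \<tau> \<in> cylinder X \<omega>. ereal (\<Sum>k<length \<omega>. f ((shift ^^ k) \<tau>)))"

definition exp_ereal :: "ereal \<Rightarrow> ennreal" where
  "exp_ereal x = (case x of ereal r \<Rightarrow> ennreal (exp r) | PInfty \<Rightarrow> \<infinity> | MInfty \<Rightarrow> 0)"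

definition ln_ennreal :: "ennreal \<Rightarrow> ereal" where
  "ln_ennreal x = (if x = 0 then -\<infinity> else if x = \<infinity> then \<infinity> else ereal (ln (enn2real x)))"

text \<open>The induced pressure of the subsystem \<open>X\<close>, with window length \<open>\<eta>\<close>. The set of words in the
  sum may be infinite; the sum is taken in \<open>[0, \<infinity>]\<close>.\<close>

definition induced_pressure ::
    "real \<Rightarrow> (nat \<Rightarrow> nat) set \<Rightarrow> ((nat \<Rightarrow> nat) \<Rightarrow> real) \<Rightarrow> ((nat \<Rightarrow> nat) \<Rightarrow> real) \<Rightarrow> nat list set \<Rightarrow> ereal"
  where
  "induced_pressure \<eta> X \<psi> \<phi> C = Limsup at_top (\<lambda>T::real. ereal (1 / T) *
     ln_ennreal (\<Sum>\<^sub>\<infinity>\<omega>\<in>{\<omega> \<in> C. ereal (T - \<eta>) < birkhoff_sup X \<psi> \<omega> \<and> birkhoff_sup X \<psi> \<omega> \<le> ereal T}.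
       exp_ereal (birkhoff_sup X \<phi> \<omega>)))"

definition words_of ::
    "nat set \<Rightarrow> (nat \<Rightarrow> nat \<Rightarrow> nat) \<Rightarrow> (nat \<Rightarrow> nat) set \<Rightarrow> nat list set" where
  "words_of I A K = {\<omega> \<in> words I A. cylinder (shift_space I A) \<omega> \<inter> K \<noteq> {}}"

text \<open>Invariance is forward invariance, \<open>\<sigma>(K) \<subseteq> K\<close>.\<close>

definition exhausting_principle ::
    "nat set \<Rightarrow> (nat \<Rightarrow> nat \<Rightarrow> nat) \<Rightarrow> real \<Rightarrow> ((nat \<Rightarrow> nat) \<Rightarrow> real) \<Rightarrow> ((nat \<Rightarrow> nat) \<Rightarrow> real) \<Rightarrow>
      nat list set \<Rightarrow> bool" where
  "exhausting_principle I A \<eta> \<psi> \<phi> C \<longleftrightarrow> (\<exists>K :: nat \<Rightarrow> (nat \<Rightarrow> nat) set.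
     (\<forall>n. K n \<subseteq> shift_space I A \<and> compactin (shift_topology I A) (K n) \<and> shift ` K n \<subseteq> K n) \<and>
     (\<lambda>n. induced_pressure \<eta> (K n) \<psi> \<phi> (C \<inter> words_of I A (K n)))
       \<longlonglongrightarrow> induced_pressure \<eta> (shift_space I A) \<psi> \<phi> C)"

definition loop_representable ::
    "nat set \<Rightarrow> (nat \<Rightarrow> nat \<Rightarrow> nat) \<Rightarrow> nat list set \<Rightarrow> bool" where
  "loop_representable I A C \<longleftrightarrow>
     (\<forall>u\<in>C. \<forall>v\<in>C. u @ v \<in> words I A \<longrightarrow> u @ v \<in> C) \<and>
     (\<forall>u v w. u \<noteq> [] \<longrightarrow> v \<noteq> [] \<longrightarrow> w \<noteq> [] \<longrightarrow> u @ v \<in> C \<longrightarrow> v @ w \<in> C \<longrightarrow> v \<in> C)"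

definition finitely_irreducible ::
    "nat set \<Rightarrow> (nat \<Rightarrow> nat \<Rightarrow> nat) \<Rightarrow> nat list set \<Rightarrow> bool" where
  "finitely_irreducible I A C \<longleftrightarrow>
     (\<exists>\<Lambda>. finite \<Lambda> \<and> \<Lambda> \<subseteq> words I A \<and> (\<forall>u\<in>C. \<forall>v\<in>C. \<exists>D \<in> \<Lambda> \<union> {[]}. u @ D @ v \<in> C))"


lemma common_length_self [simp]: "common_length \<omega> \<omega> = \<infinity>"
proof -
  have "\<not> finite (range enat)"
    by (meson enat.inject finite_imageD infinite_UNIV_nat inj_onI)
  then show ?thesis
    by (simp add: common_length_def Sup_enat_def)
qed

lemma common_length_Least:
  assumes "\<omega> \<noteq> \<omega>'"
  shows "common_length \<omega> \<omega>' = enat (LEAST i. \<omega> i \<noteq> \<omega>' i)"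
proof -
  define m where "m = (LEAST i. \<omega> i \<noteq> \<omega>' i)"
  have ne: "\<omega> m \<noteq> \<omega>' m"
    unfolding m_def by (rule LeastI_ex) (use assms in \<open>auto simp: fun_eq_iff\<close>)
  have eq: "\<omega> i = \<omega>' i" if "i < m" for i
    using that not_less_Least unfolding m_def by blast
  have "n \<le> m" if "\<forall>i<n. \<omega> i = \<omega>' i" for n
    using that ne not_less by blast
  then have "common_length \<omega> \<omega>' = enat m"
    unfolding common_length_def using eq by (intro antisym SUP_least SUP_upper) auto
  then show ?thesis by (simp add: m_def)
qed

lemma shift_dist_self [simp]: "shift_dist \<alpha> \<omega> \<omega> = 0"
  by (simp add: shift_dist_def)

lemma shift_dist_neq:
  "\<omega> \<noteq> \<omega>' \<Longrightarrow> shift_dist \<alpha> \<omega> \<omega>' = exp (- \<alpha> * real (LEAST i. \<omega> i \<noteq> \<omega>' i))"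
  by (simp add: shift_dist_def common_length_Least)

lemma Metric_space_shift_dist:
  assumes "\<alpha> > 0"
  shows "Metric_space X (shift_dist \<alpha>)"
proof
  fix x y z :: "nat \<Rightarrow> nat"
  show nonneg: "0 \<le> shift_dist \<alpha> x y" for x y
    by (cases "x = y") (auto simp: shift_dist_neq)
  show "shift_dist \<alpha> x y = shift_dist \<alpha> y x"
    by (cases "x = y") (auto simp: shift_dist_neq eq_commute)
  show "(shift_dist \<alpha> x y = 0) = (x = y)"
    by (cases "x = y") (auto simp: shift_dist_neq)
  show "shift_dist \<alpha> x z \<le> shift_dist \<alpha> x y + shift_dist \<alpha> y z"
  proof (cases "x = y \<or> y = z \<or> x = z")
    case True
    then show ?thesis using nonneg[of x y] nonneg[of y z] by auto
  next
    case False
    define m where "m u v = (LEAST i. u i \<noteq> v i)" for u v :: "nat \<Rightarrow> nat"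
    have "x (m x z) \<noteq> z (m x z)"
      unfolding m_def by (rule LeastI_ex) (use False in \<open>auto simp: fun_eq_iff\<close>)
    then have "x (m x z) \<noteq> y (m x z) \<or> y (m x z) \<noteq> z (m x z)" by metis
    then have "m x y \<le> m x z \<or> m y z \<le> m x z"
      unfolding m_def by (blast intro: Least_le)
    then have "exp (- \<alpha> * real (m x z)) \<le> exp (- \<alpha> * real (m x y)) \<or>
               exp (- \<alpha> * real (m x z)) \<le> exp (- \<alpha> * real (m y z))"
      using assms by auto
    then have "exp (- \<alpha> * real (m x z)) \<le> exp (- \<alpha> * real (m x y)) + exp (- \<alpha> * real (m y z))"
      using exp_gt_zero[of "- \<alpha> * real (m x y)"] exp_gt_zero[of "- \<alpha> * real (m y z)"] by linarith
    then show ?thesis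
      using False by (simp only: shift_dist_neq m_def not_False_eq_True de_Morgan_disj)
  qed
qed

lemma shift_dist_powr: "shift_dist \<alpha> x y = shift_dist 1 x y powr \<alpha>"
  by (cases "x = y") (auto simp: shift_dist_neq powr_def)

lemma mtopology_shift_dist:
  assumes "\<alpha> > 0"
  shows "Metric_space.mtopology (shift_space I A) (shift_dist \<alpha>) = shift_topology I A"
proof -
  interpret a: Metric_space "shift_space I A" "shift_dist \<alpha>"
    using assms by (rule Metric_space_shift_dist)
  interpret b: Metric_space "shift_space I A" "shift_dist 1"
    by (rule Metric_space_shift_dist) simp
  have "shift_dist \<alpha> x y < r powr \<alpha> \<longleftrightarrow> shift_dist 1 x y < r" if "r > 0" for x y r
  proof -
    have "shift_dist 1 x y powr \<alpha> < r powr \<alpha> \<longleftrightarrow> shift_dist 1 x y < r"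
      using that assms b.nonneg[of x y] powr_less_mono2[of \<alpha> "shift_dist 1 x y" r]
        powr_mono2[of \<alpha> r "shift_dist 1 x y"] by linarith
    then show ?thesis by (simp only: shift_dist_powr[of \<alpha>])
  qed
  then have ab: "a.mball x (r powr \<alpha>) = b.mball x r" if "r > 0" for x r
    using that by (simp add: a.mball_def b.mball_def)
  have "(\<exists>r>0. a.mball x r \<subseteq> U) \<longleftrightarrow> (\<exists>r>0. b.mball x r \<subseteq> U)" for x U
  proof
    assume "\<exists>r>0. a.mball x r \<subseteq> U"
    then obtain r where r: "r > 0" "a.mball x r \<subseteq> U" by blast
    then have "a.mball x ((r powr (1/\<alpha>)) powr \<alpha>) \<subseteq> U"
      using assms by (simp add: powr_powr)
    moreover have "r powr (1/\<alpha>) > 0" using r by simp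
    ultimately show "\<exists>r>0. b.mball x r \<subseteq> U" using ab by blast
  next
    assume "\<exists>r>0. b.mball x r \<subseteq> U"
    then obtain r where r: "r > 0" "b.mball x r \<subseteq> U" by blast
    then have "r powr \<alpha> > 0" "a.mball x (r powr \<alpha>) \<subseteq> U" using ab by auto
    then show "\<exists>r>0. a.mball x r \<subseteq> U" by blast
  qed
  then show ?thesis
    unfolding shift_topology_def topology_eq a.openin_mtopology b.openin_mtopology by simp
qed

end

theory Submission
  imports Defs "HOL-Library.Sublist"
begin

text \<open>
  Take \<open>K\<^sub>n\<close> to be the points of the shift all of whose letters are at most \<open>n\<close>. Bounded distortion
  shows that its pressure is at most that of the full shift. Conversely let \<open>p < q\<close> be smaller than the
  pressure: some window at a large \<open>T\<close> contains a finite set \<open>F\<close> of words with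
  \<open>\<Sum>\<^sub>F exp S\<phi> > exp (q T)\<close>. Concatenate words of \<open>F\<close>, joined by connecting words and separated by
  copies of a fixed marker word \<open>c\<close> on whose cylinder \<open>\<psi> \<ge> \<delta> > 0\<close>. A concatenated word can arise from
  several choices because one word of \<open>F\<close> may extend another; but such an extension by more than a
  bounded number of letters runs through a copy of \<open>c\<close> and hence raises \<open>S\<psi>\<close> by \<open>\<delta>\<close>, while all of \<open>F\<close>
  lies in one window. So the number of choices per factor is bounded independently of \<open>T\<close>, even though
  \<open>\<psi>\<close> need not be bounded away from zero, and \<open>exp ((q - p) T)\<close> outgrows this bound. The
  concatenations use finitely many letters, which gives pressure at least \<open>p\<close> on \<open>K\<^sub>n\<close> for large \<open>n\<close>.
\<close>

section \<open>Growth rates of window sums\<close>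

definition window :: "real \<Rightarrow> ('w \<Rightarrow> real) \<Rightarrow> 'w set \<Rightarrow> real \<Rightarrow> 'w set" where
  "window \<eta> a C T = {\<omega> \<in> C. T - \<eta> < a \<omega> \<and> a \<omega> \<le> T}"

definition window_sum :: "real \<Rightarrow> ('w \<Rightarrow> real) \<Rightarrow> ('w \<Rightarrow> real) \<Rightarrow> 'w set \<Rightarrow> real \<Rightarrow> ennreal" where
  "window_sum \<eta> a b C T = (\<Sum>\<^sub>\<infinity>\<omega>\<in>window \<eta> a C T. ennreal (exp (b \<omega>)))"

text \<open>The induced pressure in abstract form: \<open>a\<close> and \<open>b\<close> stand for
  the suprema of the Birkhoff sums of \<psi> and \<phi>, taken as real numbers, so that the full
  shift and its subsystems are both instances.\<close>

definition growth_rate :: "real \<Rightarrow> ('w \<Rightarrow> real) \<Rightarrow> ('w \<Rightarrow> real) \<Rightarrow> 'w set \<Rightarrow> ereal" where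
  "growth_rate \<eta> a b C = Limsup at_top (\<lambda>T. ereal (1 / T) * ln_ennreal (window_sum \<eta> a b C T))"

text \<open>Moves comparisons of rates to exponential bounds on sums; \<open>z = 0\<close> and
  \<open>z = \<infinity>\<close> fit in because their logarithms are the two infinite
  values.\<close>

lemma scaled_ln_le_iff:
  assumes "T > 0"
  shows "ereal (1 / T) * ln_ennreal z \<le> ereal p \<longleftrightarrow> z \<le> ennreal (exp (p * T))"
proof (cases z)
  case (real r)
  show ?thesis
  proof (cases "r = 0")
    case True
    then show ?thesis using real assms by (simp add: ln_ennreal_def)
  next
    case False
    then have "r > 0" using real by simp
    then have "ereal (1 / T) * ln_ennreal z = ereal (ln r / T)"
      using real by (simp add: ln_ennreal_def)
    moreover have "ln r / T \<le> p \<longleftrightarrow> r \<le> exp (p * T)"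
      using assms \<open>r > 0\<close> by (metis exp_gt_zero ln_exp ln_le_cancel_iff pos_divide_le_eq)
    ultimately show ?thesis
      using real by simp
  qed
next
  case top
  then show ?thesis using assms by (simp add: ln_ennreal_def top_unique)
qed

text \<open>A sum in [0, \<infinity>] is the supremum of its finite subsums; this reduces the
  estimates to finite sets of words.\<close>

lemma window_sum_le_iff:
  "window_sum \<eta> a b C T \<le> c \<longleftrightarrow>
    (\<forall>F. finite F \<longrightarrow> F \<subseteq> window \<eta> a C T \<longrightarrow> ennreal (\<Sum>\<omega>\<in>F. exp (b \<omega>)) \<le> c)"
proof -
  have "window_sum \<eta> a b C T =
      (SUP F\<in>{F. finite F \<and> F \<subseteq> window \<eta> a C T}. \<Sum>\<omega>\<in>F. ennreal (exp (b \<omega>)))"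
    unfolding window_sum_def by (rule nonneg_infsum_complete) simp
  then show ?thesis by (auto simp: SUP_le_iff sum_ennreal)
qed

lemma growth_rate_le:
  assumes "\<forall>\<^sub>F T in at_top. window_sum \<eta> a b C T \<le> ennreal (exp (p * T))"
  shows "growth_rate \<eta> a b C \<le> ereal p"
  unfolding growth_rate_def
proof (rule Limsup_bounded)
  show "\<forall>\<^sub>F T in at_top. ereal (1 / T) * ln_ennreal (window_sum \<eta> a b C T) \<le> ereal p"
    using assms eventually_gt_at_top[of 0] by eventually_elim (simp add: scaled_ln_le_iff)
qed

lemma growth_rate_less_imp:
  assumes "growth_rate \<eta> a b C < ereal p"
  shows "\<forall>\<^sub>F T in at_top. window_sum \<eta> a b C T \<le> ennreal (exp (p * T))"
  using Limsup_lessD[OF assms[unfolded growth_rate_def]] eventually_gt_at_top[of 0]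
  by eventually_elim (simp add: scaled_ln_le_iff[symmetric])

text \<open>Raising \<open>a\<close> by at most \<open>V\<close> moves a word from the window at
  \<open>T\<close> into one of boundedly many windows at \<open>T + j * \<eta>\<close>. A bound
  \<open>exp (p * T)\<close> therefore survives up to a constant factor, which any rate above
  \<open>p\<close> absorbs.\<close>

lemma growth_rate_mono:
  assumes "\<eta> > 0" "C \<subseteq> C'"
    and a: "\<And>\<omega>. \<omega> \<in> C \<Longrightarrow> a \<omega> \<le> a' \<omega>" "\<And>\<omega>. \<omega> \<in> C \<Longrightarrow> a' \<omega> \<le> a \<omega> + V"
    and b: "\<And>\<omega>. \<omega> \<in> C \<Longrightarrow> b \<omega> \<le> b' \<omega>"
  shows "growth_rate \<eta> a b C \<le> growth_rate \<eta> a' b' C'"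
proof (rule dense_ge)
  fix y assume "growth_rate \<eta> a' b' C' < y"
  then obtain q where q: "growth_rate \<eta> a' b' C' < ereal q" "ereal q < y"
    using ereal_dense2 by blast
  obtain p where p: "growth_rate \<eta> a' b' C' < ereal p" "p < q"
    using ereal_dense2[OF q(1)] by auto
  define m where "m = nat \<lceil>V / \<eta>\<rceil>"
  define c where "c = (\<Sum>j\<le>m. exp (p * (real j * \<eta>)))"
  obtain T0 where T0: "\<And>T. T \<ge> T0 \<Longrightarrow> window_sum \<eta> a' b' C' T \<le> ennreal (exp (p * T))"
    using growth_rate_less_imp[OF p(1)] unfolding eventually_at_top_linorder by blast
  have bound: "window_sum \<eta> a b C T \<le> ennreal (exp (p * T) * c)" if T: "T \<ge> T0" for T
    unfolding window_sum_le_iff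
  proof (intro allI impI)
    fix F assume F: "finite F" "F \<subseteq> window \<eta> a C T"
    \<comment> \<open>\<open>j \<omega>\<close> numbers the shifted window that contains
      \<open>a' \<omega>\<close>. If \<open>a' \<omega> \<le> T\<close>, the ceiling is at most 0
      and \<open>nat\<close> makes it 0; the word then stays in the window at \<open>T\<close>
      because \<open>a \<le> a'\<close>.\<close>
    define j where "j \<omega> = nat \<lceil>(a' \<omega> - T) / \<eta>\<rceil>" for \<omega>
    define G where "G i = {\<omega>\<in>F. j \<omega> = i}" for i
    have j: "j \<omega> \<le> m" "\<omega> \<in> window \<eta> a' C' (T + real (j \<omega>) * \<eta>)" if \<omega>: "\<omega> \<in> F" for \<omega>
    proof -
      have w: "\<omega> \<in> C" "T - \<eta> < a \<omega>" "a \<omega> \<le> T" using \<omega> F by (auto simp: window_def)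
      have "(a' \<omega> - T) / \<eta> \<le> V / \<eta>"
        using a[OF w(1)] w \<open>\<eta> > 0\<close> by (intro divide_right_mono) auto
      then show "j \<omega> \<le> m" unfolding j_def m_def by (intro nat_mono ceiling_mono)
      have "T + real (j \<omega>) * \<eta> - \<eta> < a' \<omega> \<and> a' \<omega> \<le> T + real (j \<omega>) * \<eta>"
      proof (cases "a' \<omega> \<le> T")
        case True
        then have "\<lceil>(a' \<omega> - T) / \<eta>\<rceil> \<le> 0" using \<open>\<eta> > 0\<close> by (simp add: divide_le_0_iff)
        then have "j \<omega> = 0" by (simp add: j_def)
        then show ?thesis using True a[OF w(1)] w by auto
      next
        case False
        then have "(a' \<omega> - T) / \<eta> > 0" using \<open>\<eta> > 0\<close> by simp
        then have "real (j \<omega>) = of_int \<lceil>(a' \<omega> - T) / \<eta>\<rceil>" by (simp add: j_def)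
        then have "real (j \<omega>) - 1 < (a' \<omega> - T) / \<eta>" "(a' \<omega> - T) / \<eta> \<le> real (j \<omega>)"
          by linarith+
        then have "(real (j \<omega>) - 1) * \<eta> < a' \<omega> - T" "a' \<omega> - T \<le> real (j \<omega>) * \<eta>"
          using \<open>\<eta> > 0\<close> by (simp_all add: pos_less_divide_eq pos_divide_le_eq)
        then show ?thesis by (auto simp: algebra_simps)
      qed
      then show "\<omega> \<in> window \<eta> a' C' (T + real (j \<omega>) * \<eta>)"
        using w \<open>C \<subseteq> C'\<close> by (auto simp: window_def)
    qed
    have "(\<Sum>\<omega>\<in>F. exp (b \<omega>)) = (\<Sum>i\<le>m. \<Sum>\<omega>\<in>G i. exp (b \<omega>))"
      unfolding G_def using F j by (intro sum.group[symmetric]) auto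
    also have "\<dots> \<le> (\<Sum>j\<le>m. exp (p * (T + real j * \<eta>)))"
    proof (rule sum_mono)
      fix i
      have "T + real i * \<eta> \<ge> T0" using T \<open>\<eta> > 0\<close> by (simp add: add_increasing2)
      moreover have "finite (G i)" "G i \<subseteq> window \<eta> a' C' (T + real i * \<eta>)"
        using F j by (auto simp: G_def)
      ultimately have "ennreal (\<Sum>\<omega>\<in>G i. exp (b' \<omega>)) \<le> ennreal (exp (p * (T + real i * \<eta>)))"
        using T0 window_sum_le_iff by blast
      then have "(\<Sum>\<omega>\<in>G i. exp (b' \<omega>)) \<le> exp (p * (T + real i * \<eta>))"
        by (simp add: ennreal_le_iff)
      moreover have "(\<Sum>\<omega>\<in>G i. exp (b \<omega>)) \<le> (\<Sum>\<omega>\<in>G i. exp (b' \<omega>))"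
        using b F by (intro sum_mono) (auto simp: G_def window_def)
      ultimately show "(\<Sum>\<omega>\<in>G i. exp (b \<omega>)) \<le> exp (p * (T + real i * \<eta>))" by simp
    qed
    also have "\<dots> = exp (p * T) * c"
      by (simp add: c_def sum_distrib_left exp_add[symmetric] algebra_simps)
    finally show "ennreal (\<Sum>\<omega>\<in>F. exp (b \<omega>)) \<le> ennreal (exp (p * T) * c)"
      by (rule ennreal_leI)
  qed
  have "c > 0" unfolding c_def by (intro sum_pos) auto
  have "\<forall>\<^sub>F T in at_top. window_sum \<eta> a b C T \<le> ennreal (exp (q * T))"
    using eventually_ge_at_top[of T0] eventually_ge_at_top[of "ln c / (q - p)"]
  proof eventually_elim
    case (elim T)
    have "ln c \<le> (q - p) * T" using elim p by (simp add: pos_divide_le_eq mult.commute)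
    then have "c \<le> exp ((q - p) * T)" using \<open>c > 0\<close> by (metis exp_le_cancel_iff exp_ln)
    then have "exp (p * T) * c \<le> exp (p * T) * exp ((q - p) * T)" by simp
    also have "\<dots> = exp (q * T)" by (simp add: exp_add[symmetric] algebra_simps)
    finally show ?case using bound[OF elim(1)] ennreal_leI order_trans by blast
  qed
  from growth_rate_le[OF this] q show "growth_rate \<eta> a b C \<le> y" by auto
qed

text \<open>A Limsup above \<open>p\<close> is witnessed at arbitrarily large \<open>T\<close>, and
  a window sum above \<open>exp (p * T)\<close> already has a finite subsum above it.\<close>

lemma less_growth_rate_imp:
  assumes "ereal p < growth_rate \<eta> a b C"
  shows "\<exists>T\<ge>T0. \<exists>F. finite F \<and> F \<subseteq> window \<eta> a C T \<and> exp (p * T) < (\<Sum>\<omega>\<in>F. exp (b \<omega>))"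
proof (rule ccontr)
  assume contra: "\<not> ?thesis"
  have "\<forall>\<^sub>F T in at_top. window_sum \<eta> a b C T \<le> ennreal (exp (p * T))"
    using eventually_ge_at_top[of T0]
  proof eventually_elim
    case (elim T)
    show ?case unfolding window_sum_le_iff
      using contra elim by (auto simp: not_less intro!: ennreal_leI)
  qed
  from growth_rate_le[OF this] assms show False by simp
qed

text \<open>If the rate were below some \<open>q < p\<close>, the windows from \<open>R\<close>
  upwards would contribute at most a geometric series to the sum of
  \<open>exp (b \<omega> - p * a \<omega>)\<close>, and this bound tends to 0 as \<open>R\<close>
  grows. The weighted form suits concatenated words, whose values of \<open>a\<close> are not
  confined to a single window.\<close>

lemma growth_rate_ge:
  assumes "\<eta> > 0"
    and heavy: "\<And>R. \<exists>F. finite F \<and> F \<subseteq> {\<omega>\<in>C. a \<omega> \<ge> R} \<and> 1 \<le> (\<Sum>\<omega>\<in>F. exp (b \<omega> - p * a \<omega>))"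
  shows "ereal p \<le> growth_rate \<eta> a b C"
proof (rule ccontr)
  assume "\<not> ?thesis"
  then have "growth_rate \<eta> a b C < ereal p" by simp
  then obtain q where q: "growth_rate \<eta> a b C < ereal q" "q < p"
    using ereal_dense2 by fastforce
  obtain T0 where T0: "\<And>T. T \<ge> T0 \<Longrightarrow> window_sum \<eta> a b C T \<le> ennreal (exp (q * T))"
    using growth_rate_less_imp[OF q(1)] unfolding eventually_at_top_linorder by blast
  \<comment> \<open>Ratio of the bounds \<open>exp (- ((p - q) * T))\<close> for consecutive
    windows.\<close>
  define x where "x = exp (- ((p - q) * \<eta>))"
  have x: "0 < x" "x < 1" using q \<open>\<eta> > 0\<close> by (simp_all add: x_def)
  define c where "c = exp (\<bar>p\<bar> * \<eta>) / (1 - x)"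
  have c: "c > 0" using x by (simp add: c_def)
  have le: "1 \<le> c * exp (- ((p - q) * R))" if R: "R \<ge> T0" for R
  proof -
    obtain F where F: "finite F" "F \<subseteq> {\<omega>\<in>C. a \<omega> \<ge> R}" "1 \<le> (\<Sum>\<omega>\<in>F. exp (b \<omega> - p * a \<omega>))"
      using heavy by blast
    \<comment> \<open>Windows are counted upwards from \<open>R\<close>; window 0 ends at
      \<open>R\<close> and receives only the value \<open>a \<omega> = R\<close>.\<close>
    define i where "i \<omega> = nat \<lceil>(a \<omega> - R) / \<eta>\<rceil>" for \<omega>
    define N where "N = Max (insert 0 (i ` F))"
    have iN: "i \<omega> \<le> N" if "\<omega> \<in> F" for \<omega> unfolding N_def using that F by (intro Max_ge) auto
    have iw: "\<omega> \<in> window \<eta> a C (R + real (i \<omega>) * \<eta>)" if "\<omega> \<in> F" for \<omega>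
    proof -
      have "a \<omega> \<ge> R" "\<omega> \<in> C" using that F by auto
      then have "(a \<omega> - R) / \<eta> \<ge> 0" using \<open>\<eta> > 0\<close> by simp
      then have "\<lceil>(a \<omega> - R) / \<eta>\<rceil> \<ge> 0" by linarith
      then have "real (i \<omega>) = of_int \<lceil>(a \<omega> - R) / \<eta>\<rceil>" by (simp add: i_def)
      then have "real (i \<omega>) - 1 < (a \<omega> - R) / \<eta>" "(a \<omega> - R) / \<eta> \<le> real (i \<omega>)"
        by linarith+
      then have "(real (i \<omega>) - 1) * \<eta> < a \<omega> - R" "a \<omega> - R \<le> real (i \<omega>) * \<eta>"
        using \<open>\<eta> > 0\<close> by (simp_all add: pos_less_divide_eq pos_divide_le_eq)
      then show ?thesis using \<open>\<omega> \<in> C\<close> by (auto simp: window_def algebra_simps)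
    qed
    have "(\<Sum>\<omega>\<in>F. exp (b \<omega> - p * a \<omega>)) = (\<Sum>j\<le>N. \<Sum>\<omega>\<in>{\<omega>\<in>F. i \<omega> = j}. exp (b \<omega> - p * a \<omega>))"
      using F iN by (intro sum.group[symmetric]) auto
    also have "\<dots> \<le> (\<Sum>j\<le>N. exp (\<bar>p\<bar> * \<eta>) * exp (- ((p - q) * R)) * x ^ j)"
    proof (rule sum_mono)
      fix j
      define T where "T = R + real j * \<eta>"
      define G where "G = {\<omega>\<in>F. i \<omega> = j}"
      have G: "finite G" "G \<subseteq> window \<eta> a C T" using F iw by (auto simp: G_def T_def)
      have "T \<ge> T0" using R \<open>\<eta> > 0\<close> by (simp add: T_def add_increasing2)
      then have "ennreal (\<Sum>\<omega>\<in>G. exp (b \<omega>)) \<le> ennreal (exp (q * T))"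
        using T0 G window_sum_le_iff by blast
      then have sumle: "(\<Sum>\<omega>\<in>G. exp (b \<omega>)) \<le> exp (q * T)" by (simp add: ennreal_le_iff)
      have "exp (b \<omega> - p * a \<omega>) \<le> exp (b \<omega>) * exp (\<bar>p\<bar> * \<eta> - p * T)" if "\<omega> \<in> G" for \<omega>
      proof -
        have "T - \<eta> < a \<omega>" "a \<omega> \<le> T" using that G by (auto simp: window_def)
        \<comment> \<open>Replacing \<open>a \<omega>\<close> by \<open>T\<close> costs at most
          \<open>\<bar>p\<bar> * \<eta>\<close>, whatever the sign of \<open>p\<close>.\<close>
        then have "\<bar>p * (T - a \<omega>)\<bar> \<le> \<bar>p\<bar> * \<eta>"
          unfolding abs_mult by (intro mult_left_mono) auto
        from abs_le_D1[OF this] have "b \<omega> - p * a \<omega> \<le> b \<omega> + (\<bar>p\<bar> * \<eta> - p * T)"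
          by (simp add: right_diff_distrib)
        then show ?thesis by (simp add: exp_add[symmetric])
      qed
      then have "(\<Sum>\<omega>\<in>G. exp (b \<omega> - p * a \<omega>)) \<le> (\<Sum>\<omega>\<in>G. exp (b \<omega>)) * exp (\<bar>p\<bar> * \<eta> - p * T)"
        unfolding sum_distrib_right by (intro sum_mono)
      also have "\<dots> \<le> exp (q * T) * exp (\<bar>p\<bar> * \<eta> - p * T)"
        using sumle by (intro mult_right_mono) auto
      also have "\<dots> = exp (\<bar>p\<bar> * \<eta>) * exp (- ((p - q) * R)) * x ^ j"
        by (simp add: x_def T_def exp_of_nat_mult[symmetric] exp_add[symmetric] algebra_simps)
      finally show "(\<Sum>\<omega>\<in>{\<omega>\<in>F. i \<omega> = j}. exp (b \<omega> - p * a \<omega>)) \<le> \<dots>" by (simp add: G_def)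
    qed
    also have "\<dots> = exp (\<bar>p\<bar> * \<eta>) * exp (- ((p - q) * R)) * (\<Sum>j<Suc N. x ^ j)"
      by (simp only: sum_distrib_left lessThan_Suc_atMost)
    also have "\<dots> \<le> exp (\<bar>p\<bar> * \<eta>) * exp (- ((p - q) * R)) * (1 / (1 - x))"
    proof (rule mult_left_mono)
      show "(\<Sum>j<Suc N. x ^ j) \<le> 1 / (1 - x)"
        unfolding sum_gp_strict using x by (simp add: divide_right_mono)
    qed simp
    finally show ?thesis using F(3) by (simp add: c_def)
  qed
  \<comment> \<open>The summand 1 forces the logarithm of the bound in \<open>le\<close> down to at
    most -1, while \<open>le\<close> requires it to be at least 0.\<close>
  define R where "R = max T0 ((ln c + 1) / (p - q))"
  have "(ln c + 1) / (p - q) \<le> R" by (simp add: R_def)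
  then have "ln c + 1 \<le> (p - q) * R"
    using q by (simp add: pos_divide_le_eq mult.commute)
  then have "ln (c * exp (- ((p - q) * R))) < 0" using c by (simp add: ln_mult)
  moreover have "ln (c * exp (- ((p - q) * R))) \<ge> 0" using le[of R] by (simp add: R_def)
  ultimately show False by simp
qed

section \<open>The shift space\<close>

definition birkhoff_sum :: "((nat \<Rightarrow> nat) \<Rightarrow> real) \<Rightarrow> nat \<Rightarrow> (nat \<Rightarrow> nat) \<Rightarrow> real" where
  "birkhoff_sum f n \<tau> = (\<Sum>k<n. f ((shift ^^ k) \<tau>))"

lemma funpow_shift: "(shift ^^ k) \<tau> = (\<lambda>i. \<tau> (k + i))"
  by (induction k arbitrary: \<tau>) (auto simp: shift_def funpow_swap1)

lemma funpow_shift_in_shift_space: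
  "\<tau> \<in> shift_space I A \<Longrightarrow> (shift ^^ k) \<tau> \<in> shift_space I A"
  by (auto simp: shift_space_def funpow_shift)

lemma birkhoff_sum_add:
  "birkhoff_sum f (m + n) \<tau> = birkhoff_sum f m \<tau> + birkhoff_sum f n ((shift ^^ m) \<tau>)"
  by (induction n) (auto simp: birkhoff_sum_def funpow_shift ac_simps)

lemma cylinder_append:
  "\<tau> \<in> cylinder (shift_space I A) (u @ v) \<longleftrightarrow>
     \<tau> \<in> cylinder (shift_space I A) u \<and> (shift ^^ length u) \<tau> \<in> cylinder (shift_space I A) v"
  if "\<tau> \<in> shift_space I A"
proof -
  have "(\<forall>i<length u + length v. \<tau> i = (u @ v) ! i) \<longleftrightarrow>
     (\<forall>i<length u. \<tau> i = u ! i) \<and> (\<forall>i<length v. \<tau> (length u + i) = v ! i)"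
  proof safe
    fix i assume *: "\<forall>i<length u + length v. \<tau> i = (u @ v) ! i"
    show "\<tau> i = u ! i" if "i < length u" using *[rule_format, of i] that by (simp add: nth_append)
    show "\<tau> (length u + i) = v ! i" if "i < length v" using *[rule_format, of "length u + i"] that by simp
  next
    fix i assume "\<forall>i<length u. \<tau> i = u ! i" "\<forall>i<length v. \<tau> (length u + i) = v ! i" "i < length u + length v"
    then show "\<tau> i = (u @ v) ! i"
      by (cases "i < length u") (auto simp: nth_append dest: spec[of _ "i - length u"])
  qed
  then show ?thesis
    using that funpow_shift_in_shift_space[OF that]
    by (auto simp: cylinder_def funpow_shift)
qed

lemma cylinder_cong:
  assumes "\<tau> \<in> cylinder (shift_space I A) (u @ v)"
  shows "\<tau> \<in> cylinder (shift_space I A) u" "(shift ^^ length u) \<tau> \<in> cylinder (shift_space I A) v"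
  using assms cylinder_append[of \<tau> I A u v] by (auto simp: cylinder_def)

text \<open>The bound decreases in \<open>n\<close>, so any known number \<open>n > 0\<close> of
  common letters may replace the exact length that enters the metric.\<close>

lemma Hoelder_on_common_prefix:
  assumes "Hoelder_continuous X f"
  shows "\<exists>\<alpha>>0. \<exists>V\<ge>0. \<forall>\<omega>\<in>X. \<forall>\<omega>'\<in>X. \<forall>n>0. (\<forall>i<n. \<omega> i = \<omega>' i) \<longrightarrow>
    \<bar>f \<omega> - f \<omega>'\<bar> \<le> V * exp (- \<alpha> * real n)"
proof -
  obtain \<alpha> V where \<alpha>: "\<alpha> > 0" and V: "V \<ge> 0" and hold: "\<And>\<omega> \<omega>'. \<omega> \<in> X \<Longrightarrow> \<omega>' \<in> X \<Longrightarrow>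
     common_length \<omega> \<omega>' \<ge> 1 \<Longrightarrow> \<bar>f \<omega> - f \<omega>'\<bar> \<le> V * shift_dist \<alpha> \<omega> \<omega>'"
    using assms unfolding Hoelder_continuous_def by blast
  have "\<forall>\<omega>\<in>X. \<forall>\<omega>'\<in>X. \<forall>n>0. (\<forall>i<n. \<omega> i = \<omega>' i) \<longrightarrow> \<bar>f \<omega> - f \<omega>'\<bar> \<le> V * exp (- \<alpha> * real n)"
  proof (intro ballI allI impI)
    fix \<omega> \<omega>' :: "nat \<Rightarrow> nat" and n :: nat
    assume \<omega>: "\<omega> \<in> X" "\<omega>' \<in> X" and n: "n > 0" and eq: "\<forall>i<n. \<omega> i = \<omega>' i"
    show "\<bar>f \<omega> - f \<omega>'\<bar> \<le> V * exp (- \<alpha> * real n)"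
    proof (cases "\<omega> = \<omega>'")
      case True
      then show ?thesis using V by simp
    next
      case False
      define m where "m = (LEAST i. \<omega> i \<noteq> \<omega>' i)"
      have "\<omega> m \<noteq> \<omega>' m"
        unfolding m_def by (rule LeastI_ex) (use False in \<open>auto simp: fun_eq_iff\<close>)
      then have nm: "n \<le> m" using eq not_less by blast
      have "common_length \<omega> \<omega>' \<ge> 1"
        using n nm False by (simp add: common_length_Least m_def one_enat_def)
      then have "\<bar>f \<omega> - f \<omega>'\<bar> \<le> V * shift_dist \<alpha> \<omega> \<omega>'" using hold \<omega> by blast
      also have "\<dots> = V * exp (- \<alpha> * real m)" using False by (simp add: shift_dist_neq m_def)
      also have "\<dots> \<le> V * exp (- \<alpha> * real n)" using V \<alpha> nm by (intro mult_left_mono) auto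
      finally show ?thesis .
    qed
  qed
  then show ?thesis using \<alpha> V by blast
qed

text \<open>The k-th shifts of two points of the cylinder still share
  \<open>length \<omega> - k\<close> letters, so the differences of the summands are dominated by a
  geometric series whose sum does not depend on the word.\<close>

lemma bounded_distortion:
  assumes "Hoelder_continuous (shift_space I A) f"
  obtains V where "V \<ge> 0" "\<And>\<omega> \<tau> \<tau>'. \<tau> \<in> cylinder (shift_space I A) \<omega> \<Longrightarrow> \<tau>' \<in> cylinder (shift_space I A) \<omega> \<Longrightarrow>
     birkhoff_sum f (length \<omega>) \<tau> \<le> birkhoff_sum f (length \<omega>) \<tau>' + V"
proof -
  obtain \<alpha> V where \<alpha>: "\<alpha> > 0" and V: "V \<ge> 0"
    and hold: "\<And>\<omega> \<omega>' n. \<omega> \<in> shift_space I A \<Longrightarrow> \<omega>' \<in> shift_space I A \<Longrightarrow> n > 0 \<Longrightarrow>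
       \<forall>i<n. \<omega> i = \<omega>' i \<Longrightarrow> \<bar>f \<omega> - f \<omega>'\<bar> \<le> V * exp (- \<alpha> * real n)"
    using Hoelder_on_common_prefix[OF assms] by metis
  define x where "x = exp (- \<alpha>)"
  have x: "0 < x" "x < 1" using \<alpha> by (auto simp: x_def)
  show ?thesis
  proof (rule that[of "V / (1 - x)"])
    show "0 \<le> V / (1 - x)" using V x by simp
    fix \<omega> \<tau> \<tau>' assume \<tau>: "\<tau> \<in> cylinder (shift_space I A) \<omega>" "\<tau>' \<in> cylinder (shift_space I A) \<omega>"
    define n where "n = length \<omega>"
    have "birkhoff_sum f n \<tau> - birkhoff_sum f n \<tau>' = (\<Sum>k<n. f ((shift ^^ k) \<tau>) - f ((shift ^^ k) \<tau>'))"
      by (simp add: birkhoff_sum_def sum_subtractf)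
    also have "\<dots> \<le> (\<Sum>k<n. V * x ^ (n - k))"
    proof (rule sum_mono)
      fix k assume "k \<in> {..<n}"
      then have k: "k < n" by simp
      have "f ((shift ^^ k) \<tau>) - f ((shift ^^ k) \<tau>') \<le> V * exp (- \<alpha> * real (n - k))"
      proof (rule order_trans[OF abs_ge_self], rule hold)
        show "\<forall>i<n - k. (shift ^^ k) \<tau> i = (shift ^^ k) \<tau>' i"
          using \<tau> by (auto simp: funpow_shift cylinder_def n_def less_diff_conv add.commute)
      qed (use \<tau> k in \<open>auto simp: cylinder_def intro: funpow_shift_in_shift_space\<close>)
      then show "f ((shift ^^ k) \<tau>) - f ((shift ^^ k) \<tau>') \<le> V * x ^ (n - k)"
        by (simp add: x_def exp_of_nat_mult[symmetric] mult.commute)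
    qed
    also have "\<dots> = V * (\<Sum>k<n. x ^ Suc k)"
      unfolding sum_distrib_left
      by (rule sum.reindex_bij_witness[of _ "\<lambda>k. n - Suc k" "\<lambda>k. n - Suc k"]) (auto simp: Suc_diff_Suc)
    also have "\<dots> \<le> V * (\<Sum>k<n. x ^ k)"
      using x V by (intro mult_left_mono sum_mono power_decreasing) auto
    also have "\<dots> \<le> V * (1 / (1 - x))"
      unfolding sum_gp_strict using x V by (intro mult_left_mono) (auto simp: divide_right_mono)
    finally show "birkhoff_sum f (length \<omega>) \<tau> \<le> birkhoff_sum f (length \<omega>) \<tau>' + V / (1 - x)"
      by (simp add: n_def)
  qed
qed

lemma birkhoff_sup_eq: "birkhoff_sup X f \<omega> = (SUP \<tau>\<in>cylinder X \<omega>. ereal (birkhoff_sum f (length \<omega>) \<tau>))"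
  by (simp add: birkhoff_sup_def birkhoff_sum_def)

text \<open>Agrees with the supremum only where that is finite, since \<open>real_of_ereal\<close>
  sends both infinities to 0; words with empty cylinder have to be kept out.\<close>

definition real_birkhoff_sup :: "(nat \<Rightarrow> nat) set \<Rightarrow> ((nat \<Rightarrow> nat) \<Rightarrow> real) \<Rightarrow> nat list \<Rightarrow> real" where
  "real_birkhoff_sup X f \<omega> = real_of_ereal (birkhoff_sup X f \<omega>)"

text \<open>A point of the cylinder in \<open>Y\<close> bounds the supremum from below, and
  distortion turns every point of the cylinder in \<open>X\<close> into an upper bound. Two sets
  occur because the distortion constant of the full shift also serves its subsystems.\<close>

lemma birkhoff_sup_bounds:
  assumes dist: "\<And>\<tau> \<tau>'. \<tau> \<in> cylinder X \<omega> \<Longrightarrow> \<tau>' \<in> cylinder X \<omega> \<Longrightarrow>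
     birkhoff_sum f (length \<omega>) \<tau> \<le> birkhoff_sum f (length \<omega>) \<tau>' + V"
    and "Y \<subseteq> X" and ne: "cylinder Y \<omega> \<noteq> {}"
  shows "birkhoff_sup Y f \<omega> = ereal (real_birkhoff_sup Y f \<omega>)"
    and "\<tau> \<in> cylinder Y \<omega> \<Longrightarrow> birkhoff_sum f (length \<omega>) \<tau> \<le> real_birkhoff_sup Y f \<omega>"
    and "\<tau> \<in> cylinder X \<omega> \<Longrightarrow> real_birkhoff_sup Y f \<omega> \<le> birkhoff_sum f (length \<omega>) \<tau> + V"
proof -
  have YX: "cylinder Y \<omega> \<subseteq> cylinder X \<omega>" using \<open>Y \<subseteq> X\<close> by (auto simp: cylinder_def)
  have up: "birkhoff_sup Y f \<omega> \<le> ereal (birkhoff_sum f (length \<omega>) \<tau> + V)" if "\<tau> \<in> cylinder X \<omega>" for \<tau>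
    unfolding birkhoff_sup_eq using dist that YX by (intro SUP_least) auto
  have lo: "ereal (birkhoff_sum f (length \<omega>) \<tau>) \<le> birkhoff_sup Y f \<omega>" if "\<tau> \<in> cylinder Y \<omega>" for \<tau>
    unfolding birkhoff_sup_eq using that by (rule SUP_upper)
  obtain \<tau>0 where "\<tau>0 \<in> cylinder Y \<omega>" using ne by blast
  with up[of \<tau>0] lo[of \<tau>0] YX have "\<bar>birkhoff_sup Y f \<omega>\<bar> \<noteq> \<infinity>" by auto
  then show eq: "birkhoff_sup Y f \<omega> = ereal (real_birkhoff_sup Y f \<omega>)"
    by (simp add: real_birkhoff_sup_def ereal_real)
  show "\<tau> \<in> cylinder Y \<omega> \<Longrightarrow> birkhoff_sum f (length \<omega>) \<tau> \<le> real_birkhoff_sup Y f \<omega>"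
    using lo unfolding eq by auto
  show "\<tau> \<in> cylinder X \<omega> \<Longrightarrow> real_birkhoff_sup Y f \<omega> \<le> birkhoff_sum f (length \<omega>) \<tau> + V"
    using up unfolding eq by auto
qed

lemma induced_pressure_eq_growth_rate:
  assumes "\<And>\<omega>. \<omega> \<in> C \<Longrightarrow> birkhoff_sup X \<psi> \<omega> = ereal (real_birkhoff_sup X \<psi> \<omega>)"
    and "\<And>\<omega>. \<omega> \<in> C \<Longrightarrow> birkhoff_sup X \<phi> \<omega> = ereal (real_birkhoff_sup X \<phi> \<omega>)"
  shows "induced_pressure \<eta> X \<psi> \<phi> C =
    growth_rate \<eta> (real_birkhoff_sup X \<psi>) (real_birkhoff_sup X \<phi>) C"
proof -
  have "{\<omega> \<in> C. ereal (T - \<eta>) < birkhoff_sup X \<psi> \<omega> \<and> birkhoff_sup X \<psi> \<omega> \<le> ereal T} =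
      window \<eta> (real_birkhoff_sup X \<psi>) C T" for T
    using assms(1) by (auto simp: window_def)
  moreover have "(\<Sum>\<^sub>\<infinity>\<omega>\<in>window \<eta> (real_birkhoff_sup X \<psi>) C T. exp_ereal (birkhoff_sup X \<phi> \<omega>)) =
      window_sum \<eta> (real_birkhoff_sup X \<psi>) (real_birkhoff_sup X \<phi>) C T" for T
    unfolding window_sum_def by (rule infsum_cong) (simp add: window_def assms(2) exp_ereal_def)
  ultimately show ?thesis by (simp add: induced_pressure_def growth_rate_def)
qed

section \<open>Compact invariant subsystems over finite alphabets\<close>

definition bounded_letters :: "(nat \<Rightarrow> nat) set \<Rightarrow> nat \<Rightarrow> (nat \<Rightarrow> nat) set" where
  "bounded_letters X n = {\<tau> \<in> X. \<forall>i. \<tau> i \<le> n}"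

text \<open>Sequences with letters at most \<open>n\<close> form a product of finite sets, compact
  by Tychonoff, and admissibility cuts out a closed subset. Compactness then passes through the
  identity map from the product topology to the metric topology.\<close>

lemma compactin_bounded_letters:
  "compactin (shift_topology I A) (bounded_letters (shift_space I A) n)"
proof -
  interpret Metric_space "shift_space I A" "shift_dist 1"
    by (rule Metric_space_shift_dist) simp
  define P :: "(nat \<Rightarrow> nat) topology" where "P = product_topology (\<lambda>_. discrete_topology UNIV) UNIV"
  define K where "K = bounded_letters (shift_space I A) n"
  \<comment> \<open>Each admissibility condition involves two neighbouring letters only; it is
    closed because every set is closed in the discrete space of pairs.\<close>
  have cont: "continuous_map P (discrete_topology UNIV) (\<lambda>\<tau>. (\<tau> i, \<tau> (Suc i)))" for i
  proof -
    have c: "continuous_map P (discrete_topology UNIV) (\<lambda>\<tau>. \<tau> j)" for j :: nat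
      unfolding P_def by (rule continuous_map_product_projection) simp
    have "continuous_map P (prod_topology (discrete_topology UNIV) (discrete_topology UNIV)) (\<lambda>\<tau>. (\<tau> i, \<tau> (Suc i)))"
      using c by (simp add: continuous_map_pairwise o_def)
    then show ?thesis by (metis UNIV_Times_UNIV prod_topology_discrete_topology)
  qed
  have top: "topspace P = UNIV" by (simp add: P_def)
  have "compactin P (PiE UNIV (\<lambda>_. {..n}))"
    unfolding P_def compactin_PiE by (simp add: compactin_discrete_topology)
  moreover have "closedin P {\<tau>. \<forall>i. \<tau> i \<in> I \<and> A (\<tau> i) (\<tau> (Suc i)) = 1}"
  proof -
    have "closedin P {\<tau> \<in> topspace P. (\<tau> i, \<tau> (Suc i)) \<in> {(x, y). x \<in> I \<and> A x y = 1}}" for i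
      by (rule closedin_continuous_map_preimage[OF cont]) simp
    then have "closedin P (\<Inter>i. {\<tau>. \<tau> i \<in> I \<and> A (\<tau> i) (\<tau> (Suc i)) = 1})"
      by (intro closedin_INT) (auto simp: top)
    also have "(\<Inter>i. {\<tau>. \<tau> i \<in> I \<and> A (\<tau> i) (\<tau> (Suc i)) = 1}) = {\<tau>. \<forall>i. \<tau> i \<in> I \<and> A (\<tau> i) (\<tau> (Suc i)) = 1}"
      by blast
    finally show ?thesis .
  qed
  ultimately have "compactin P (PiE UNIV (\<lambda>_. {..n}) \<inter> shift_space I A)"
    by (metis closed_Int_compactin inf_commute shift_space_def)
  moreover have "PiE UNIV (\<lambda>_. {..n}) \<inter> shift_space I A = K"
    by (auto simp: K_def bounded_letters_def PiE_def Pi_def)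
  ultimately have "compactin P K" by simp
  then have comp: "compactin (subtopology P (shift_space I A)) K"
    by (simp add: compactin_subtopology K_def bounded_letters_def)
  have "continuous_map (subtopology P (shift_space I A)) mtopology (\<lambda>\<tau>. \<tau>)"
    unfolding continuous_map_to_metric
  proof (intro ballI allI impI)
    fix \<tau> and \<epsilon> :: real assume \<tau>: "\<tau> \<in> topspace (subtopology P (shift_space I A))" and "\<epsilon> > 0"
    then have X: "\<tau> \<in> shift_space I A" by simp
    obtain m :: nat where m: "exp (- real m) < \<epsilon>"
    proof -
      obtain m :: nat where "- ln \<epsilon> < real m" using reals_Archimedean2 by blast
      then have "exp (- real m) < exp (ln \<epsilon>)" by simp
      then show ?thesis using that \<open>\<epsilon> > 0\<close> by simp
    qed
    \<comment> \<open>Agreement in the first \<open>m\<close> letters forces the distance to be at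
      most \<open>exp (- real m)\<close>.\<close>
    define U where "U = (PiE UNIV (\<lambda>i. if i < m then {\<tau> i} else UNIV)) \<inter> shift_space I A"
    have "openin P (PiE UNIV (\<lambda>i. if i < m then {\<tau> i} else UNIV))"
      unfolding P_def by (rule product_topology_basis) (auto intro: finite_subset[of _ "{..<m}"])
    then have "openin (subtopology P (shift_space I A)) U"
      unfolding U_def openin_subtopology by blast
    moreover have "\<tau> \<in> U" using X by (auto simp: U_def)
    moreover have "\<tau>' \<in> mball \<tau> \<epsilon>" if "\<tau>' \<in> U" for \<tau>'
    proof (cases "\<tau> = \<tau>'")
      case True
      then show ?thesis using X \<open>\<epsilon> > 0\<close> by simp
    next
      case False
      have eq: "\<tau> i = \<tau>' i" if "i < m" for i
        using \<open>\<tau>' \<in> U\<close> that by (auto simp: U_def PiE_def Pi_def split: if_splits)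
      have "\<tau> (LEAST i. \<tau> i \<noteq> \<tau>' i) \<noteq> \<tau>' (LEAST i. \<tau> i \<noteq> \<tau>' i)"
        by (rule LeastI_ex) (use False in \<open>auto simp: fun_eq_iff\<close>)
      then have "m \<le> (LEAST i. \<tau> i \<noteq> \<tau>' i)" using eq not_less by blast
      then have "shift_dist 1 \<tau> \<tau>' \<le> exp (- real m)" using False by (simp add: shift_dist_neq)
      then show ?thesis using m X that by (auto simp: U_def)
    qed
    ultimately show "\<exists>U. openin (subtopology P (shift_space I A)) U \<and> \<tau> \<in> U \<and> (\<forall>y\<in>U. y \<in> mball \<tau> \<epsilon>)"
      by blast
  qed
  from image_compactin[OF comp this] show ?thesis
    by (simp add: K_def shift_topology_def)
qed

lemma shift_bounded_letters:
  "shift ` bounded_letters (shift_space I A) n \<subseteq> bounded_letters (shift_space I A) n"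
  by (auto simp: bounded_letters_def shift_def shift_space_def)

text \<open>Repeat \<open>u @ D\<close> periodically: the only transition not inside
  \<open>u @ D\<close> leads from its last letter to the first letter of \<open>u\<close>, and
  \<open>u @ D @ u\<close> contains it.\<close>

lemma periodic_point:
  assumes "u @ D @ u \<in> words I A" "u \<noteq> []"
  obtains \<tau> where "\<tau> \<in> cylinder (shift_space I A) u" "range \<tau> \<subseteq> set u \<union> set D"
proof -
  define w where "w = u @ D"
  define m where "m = length w"
  \<comment> \<open>One period and the beginning of the next: every transition of the periodic
    sequence, also the one across the seam, occurs in \<open>v\<close>.\<close>
  define v where "v = w @ u"
  define \<tau> where "\<tau> i = w ! (i mod m)" for i
  have m: "m > 0" using assms by (simp add: m_def w_def)
  have v: "v \<in> words I A" using assms by (simp add: v_def w_def)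
  have vw: "v ! i = w ! i" if "i < m" for i using that by (simp add: v_def m_def nth_append)
  have in_set: "w ! (i mod m) \<in> set w" for i using m by (auto simp: m_def)
  show ?thesis
  proof
    have "A (\<tau> i) (\<tau> (Suc i)) = 1" for i
    proof -
      let ?j = "i mod m"
      have j: "?j < m" using m by simp
      have "length u > 0" using assms by simp
      then have len: "Suc ?j < length v" using j unfolding v_def m_def length_append by linarith
      have "\<tau> (Suc i) = v ! Suc ?j"
      proof (cases "Suc ?j = m")
        case True
        then have "\<tau> (Suc i) = w ! 0" by (simp add: \<tau>_def mod_Suc)
        also have "\<dots> = v ! m" using assms by (simp add: v_def m_def w_def nth_append)
        finally show ?thesis using True by simp
      next
        case False
        then show ?thesis using j vw[of "Suc ?j"] by (simp add: \<tau>_def mod_Suc)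
      qed
      moreover have "\<tau> i = v ! ?j" using j vw by (simp add: \<tau>_def)
      ultimately show ?thesis using v len by (auto simp: words_def)
    qed
    moreover have "\<tau> i \<in> I" for i
      using v in_set[of i] by (auto simp: \<tau>_def words_def v_def)
    moreover have "\<tau> i = u ! i" if "i < length u" for i
      using that by (simp add: \<tau>_def w_def m_def nth_append)
    ultimately show "\<tau> \<in> cylinder (shift_space I A) u" by (auto simp: cylinder_def shift_space_def)
    show "range \<tau> \<subseteq> set u \<union> set D" using in_set by (auto simp: \<tau>_def w_def)
  qed
qed

section \<open>Concatenation of words\<close>

lemma real_birkhoff_sup_mono:
  assumes "Y \<subseteq> X" "birkhoff_sup Y f \<omega> = ereal (real_birkhoff_sup Y f \<omega>)"
    "birkhoff_sup X f \<omega> = ereal (real_birkhoff_sup X f \<omega>)"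
  shows "real_birkhoff_sup Y f \<omega> \<le> real_birkhoff_sup X f \<omega>"
proof -
  have "birkhoff_sup Y f \<omega> \<le> birkhoff_sup X f \<omega>"
    unfolding birkhoff_sup_def using assms(1) by (intro SUP_subset_mono) (auto simp: cylinder_def)
  then show ?thesis using assms by simp
qed

section \<open>Weighted counting of iterated extensions\<close>

definition lists_over :: "'w set \<Rightarrow> nat \<Rightarrow> 'w list set" where
  "lists_over F k = {ws. set ws \<subseteq> F \<and> length ws = k}"

lemma lists_over_0: "lists_over F 0 = {[]}"
  by (auto simp: lists_over_def)

lemma lists_over_Suc: "lists_over F (Suc k) = (\<lambda>(\<omega>, ws). \<omega> # ws) ` (F \<times> lists_over F k)"
  by (auto simp: lists_over_def image_iff length_Suc_conv)

lemma finite_lists_over: "finite F \<Longrightarrow> finite (lists_over F k)"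
  by (simp add: lists_over_def finite_lists_length_eq)

lemma foldl_invariant:
  assumes "\<And>s \<omega>. P s \<Longrightarrow> \<omega> \<in> F \<Longrightarrow> P (step s \<omega>)" "P s" "set ws \<subseteq> F"
  shows "P (foldl step s ws)"
  using assms(2,3) by (induction ws arbitrary: s) (auto intro: assms(1))

lemma prefix_foldl:
  assumes "\<And>s \<omega>. prefix s (step s \<omega>)"
  shows "prefix s (foldl step s ws)"
proof (induction ws arbitrary: s)
  case (Cons \<omega> ws)
  then show ?case using assms prefix_order.trans by fastforce
qed simp

text \<open>Since a step only appends letters, a list leading to \<open>W\<close> must begin with
  some \<open>\<omega>\<close> for which \<open>step s \<omega>\<close> is a prefix of
  \<open>W\<close>. At most \<open>M\<close> choices qualify, and the same holds at every later
  step.\<close>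

lemma card_foldl_fibre_le:
  fixes step :: "'a list \<Rightarrow> 'w \<Rightarrow> 'a list"
  assumes "finite F" and step: "\<And>s \<omega>. s \<in> C \<Longrightarrow> \<omega> \<in> F \<Longrightarrow> step s \<omega> \<in> C"
    and prefix: "\<And>s \<omega>. prefix s (step s \<omega>)"
    and card: "\<And>s. s \<in> C \<Longrightarrow> card {\<omega>\<in>F. prefix (step s \<omega>) W} \<le> M"
    and "s \<in> C"
  shows "card {ws \<in> lists_over F k. foldl step s ws = W} \<le> M ^ k"
  using \<open>s \<in> C\<close>
proof (induction k arbitrary: s)
  case 0
  have "card {ws \<in> lists_over F 0. foldl step s ws = W} \<le> card {[] :: 'w list}"
    by (rule card_mono) (auto simp: lists_over_0)
  then show ?case by simp
next
  case (Suc k)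
  let ?B = "{\<omega>\<in>F. prefix (step s \<omega>) W}"
  let ?L = "\<lambda>\<omega>. {ws \<in> lists_over F k. foldl step (step s \<omega>) ws = W}"
  have fin: "finite ?B" "finite (?L \<omega>)" for \<omega> using \<open>finite F\<close> by (auto simp: finite_lists_over)
  have "{ws \<in> lists_over F (Suc k). foldl step s ws = W} \<subseteq> (\<Union>\<omega>\<in>?B. (#) \<omega> ` ?L \<omega>)"
    using prefix_foldl[of step, OF prefix] by (auto simp: lists_over_Suc)
  then have "card {ws \<in> lists_over F (Suc k). foldl step s ws = W} \<le> card (\<Union>\<omega>\<in>?B. (#) \<omega> ` ?L \<omega>)"
    using fin by (intro card_mono) auto
  also have "\<dots> \<le> (\<Sum>\<omega>\<in>?B. card ((#) \<omega> ` ?L \<omega>))" by (rule card_UN_le) (rule fin)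
  also have "\<dots> \<le> (\<Sum>\<omega>\<in>?B. M ^ k)"
  proof (rule sum_mono)
    fix \<omega> assume "\<omega> \<in> ?B"
    then have "card (?L \<omega>) \<le> M ^ k" using Suc step by blast
    then show "card ((#) \<omega> ` ?L \<omega>) \<le> M ^ k"
      using card_image_le[of "?L \<omega>" "(#) \<omega>"] fin by (meson order_trans)
  qed
  also have "\<dots> \<le> M * M ^ k" using card[OF Suc.prems] by simp
  finally show ?case by simp
qed

text \<open>Superadditivity of \<open>h\<close> along the steps lets the k-th power of the sum be
  expanded over all lists of \<open>k\<close> choices.\<close>

lemma sum_exp_foldl_ge:
  fixes h :: "'s \<Rightarrow> real"
  assumes "finite F" and step: "\<And>s \<omega>. s \<in> C \<Longrightarrow> \<omega> \<in> F \<Longrightarrow> step s \<omega> \<in> C"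
    and h: "\<And>s \<omega>. s \<in> C \<Longrightarrow> \<omega> \<in> F \<Longrightarrow> h (step s \<omega>) \<ge> h s + g \<omega>"
    and "s \<in> C"
  shows "exp (h s) * (\<Sum>\<omega>\<in>F. exp (g \<omega>)) ^ k \<le> (\<Sum>ws\<in>lists_over F k. exp (h (foldl step s ws)))"
  using \<open>s \<in> C\<close>
proof (induction k arbitrary: s)
  case 0
  then show ?case by (simp add: lists_over_0)
next
  case (Suc k)
  let ?\<Theta> = "\<Sum>\<omega>\<in>F. exp (g \<omega>)"
  have pos: "?\<Theta> \<ge> 0" by (intro sum_nonneg) simp
  have "exp (h s) * ?\<Theta> ^ Suc k = (\<Sum>\<omega>\<in>F. exp (h s + g \<omega>) * ?\<Theta> ^ k)"
    by (simp add: exp_add sum_distrib_left sum_distrib_right mult.assoc)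
  also have "\<dots> \<le> (\<Sum>\<omega>\<in>F. exp (h (step s \<omega>)) * ?\<Theta> ^ k)"
    using h Suc.prems pos by (intro sum_mono mult_right_mono) auto
  also have "\<dots> \<le> (\<Sum>\<omega>\<in>F. \<Sum>ws\<in>lists_over F k. exp (h (foldl step (step s \<omega>) ws)))"
    using Suc step by (intro sum_mono) blast
  also have "\<dots> = (\<Sum>(\<omega>, ws)\<in>F \<times> lists_over F k. exp (h (foldl step s (\<omega> # ws))))"
    using assms(1) by (simp add: sum.cartesian_product finite_lists_over)
  also have "\<dots> = (\<Sum>ws\<in>lists_over F (Suc k). exp (h (foldl step s ws)))"
    unfolding lists_over_Suc by (subst sum.reindex) (auto simp: inj_on_def case_prod_unfold)
  finally show ?case .
qed

text \<open>Counting words instead of lists loses at most the factor \<open>M ^ k\<close>; a weight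
  of at least \<open>2 * M\<close> per step leaves the gain \<open>2 ^ k\<close>.\<close>

lemma sum_exp_foldl_image_ge:
  fixes step :: "'a list \<Rightarrow> 'w \<Rightarrow> 'a list"
  assumes "finite F" and step: "\<And>s \<omega>. s \<in> C \<Longrightarrow> \<omega> \<in> F \<Longrightarrow> step s \<omega> \<in> C"
    and prefix: "\<And>s \<omega>. prefix s (step s \<omega>)"
    and card: "\<And>s W. s \<in> C \<Longrightarrow> W \<in> C \<Longrightarrow> card {\<omega>\<in>F. prefix (step s \<omega>) W} \<le> M"
    and h: "\<And>s \<omega>. s \<in> C \<Longrightarrow> \<omega> \<in> F \<Longrightarrow> h (step s \<omega>) \<ge> h s + g \<omega>"
    and "s \<in> C" and "M > 0" and large: "(\<Sum>\<omega>\<in>F. exp (g \<omega>)) \<ge> 2 * real M"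
  shows "exp (h s) * 2 ^ k \<le> (\<Sum>W\<in>foldl step s ` lists_over F k. exp (h W))"
proof -
  let ?L = "lists_over F k" and ?W = "foldl step s ` lists_over F k"
  have "exp (h s) * (2 ^ k * real M ^ k) \<le> exp (h s) * (\<Sum>\<omega>\<in>F. exp (g \<omega>)) ^ k"
    unfolding power_mult_distrib[symmetric] using large by (intro mult_left_mono power_mono) auto
  also have "\<dots> \<le> (\<Sum>ws\<in>?L. exp (h (foldl step s ws)))"
    by (rule sum_exp_foldl_ge[where C = C]) (use assms(1) step h \<open>s \<in> C\<close> in auto)
  also have "\<dots> = (\<Sum>W\<in>?W. \<Sum>ws\<in>{ws. ws \<in> ?L \<and> foldl step s ws = W}. exp (h (foldl step s ws)))"
    by (rule sum.image_gen) (rule finite_lists_over[OF assms(1)])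
  also have "\<dots> = (\<Sum>W\<in>?W. real (card {ws \<in> ?L. foldl step s ws = W}) * exp (h W))"
    by (intro sum.cong refl) simp
  also have "\<dots> \<le> (\<Sum>W\<in>?W. real M ^ k * exp (h W))"
  proof (intro sum_mono mult_right_mono)
    fix W assume "W \<in> ?W"
    then have "W \<in> C"
      using foldl_invariant[where P = "\<lambda>s. s \<in> C" and F = F] step \<open>s \<in> C\<close> by (auto simp: lists_over_def)
    then have "card {ws \<in> ?L. foldl step s ws = W} \<le> M ^ k"
      by (intro card_foldl_fibre_le[OF assms(1) step prefix card]) (use \<open>s \<in> C\<close> in auto)
    then show "real (card {ws \<in> ?L. foldl step s ws = W}) \<le> real M ^ k"
      by (metis of_nat_le_iff of_nat_power)
  qed simp
  also have "\<dots> = real M ^ k * (\<Sum>W\<in>?W. exp (h W))" by (simp add: sum_distrib_left)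
  finally have "real M ^ k * (exp (h s) * 2 ^ k) \<le> real M ^ k * (\<Sum>W\<in>?W. exp (h W))"
    by (simp add: mult_ac)
  then show ?thesis using \<open>M > 0\<close> by (simp add: mult_le_cancel_left_pos)
qed

section \<open>Words joined by connectors\<close>

text \<open>The choice function \<open>glue\<close> makes concatenation within \<open>C\<close> a
  deterministic operation.\<close>

locale glued_words =
  fixes I :: "nat set" and A :: "nat \<Rightarrow> nat \<Rightarrow> nat" and C :: "nat list set"
    and \<Lambda> :: "nat list set" and glue :: "nat list \<Rightarrow> nat list \<Rightarrow> nat list"
  assumes C_words: "C \<subseteq> words I A" and finite_\<Lambda>: "finite \<Lambda>"
    and glue_in: "u \<in> C \<Longrightarrow> v \<in> C \<Longrightarrow> glue u v \<in> \<Lambda>"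
    and glue: "u \<in> C \<Longrightarrow> v \<in> C \<Longrightarrow> u @ glue u v @ v \<in> C"
begin

abbreviation "X \<equiv> shift_space I A"

lemma C_nonempty: "u \<in> C \<Longrightarrow> u \<noteq> []"
  using C_words by (auto simp: words_def)

text \<open>Gluing \<open>u\<close> to itself gives a loop, and the periodic point that follows it
  meets only letters of \<open>u\<close> and of one connector.\<close>

lemma cylinder_bounded_letters_nonempty:
  assumes "u \<in> C" "set u \<subseteq> {..n}" "\<And>D. D \<in> \<Lambda> \<Longrightarrow> set D \<subseteq> {..n}"
  shows "cylinder (bounded_letters X n) u \<noteq> {}"
proof -
  obtain \<tau> where \<tau>: "\<tau> \<in> cylinder X u" "range \<tau> \<subseteq> set u \<union> set (glue u u)"
    using periodic_point glue[OF assms(1,1)] C_words C_nonempty assms(1) by blast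
  then have "\<tau> i \<le> n" for i
    using assms(2) assms(3)[OF glue_in[OF assms(1,1)]] by (meson Un_least atMost_iff rangeI subsetD)
  then show ?thesis using \<tau> by (auto simp: cylinder_def bounded_letters_def)
qed

text \<open>An admissible word need not extend to a point of the shift, but a word of
  \<open>C\<close> does, as it can be glued to itself.\<close>

lemma cylinder_nonempty: "u \<in> C \<Longrightarrow> cylinder X u \<noteq> {}"
  using periodic_point glue C_words C_nonempty by (metis empty_iff subsetD)

text \<open>Along one point of the long cylinder the Birkhoff sum splits into five blocks. The
  suprema differ from the sums along this point by at most \<open>V\<close>, and \<open>E\<close>,
  \<open>D\<close>, \<open>c\<close> come from a finite set, so the error is independent of
  \<open>s\<close> and \<open>\<omega>\<close>.\<close>

lemma quasi_additive:
  assumes "Hoelder_continuous X f"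
  shows "\<exists>\<kappa>. \<forall>s\<in>C. \<forall>E\<in>\<Lambda>. \<forall>\<omega>\<in>C. \<forall>D\<in>\<Lambda>. s @ E @ \<omega> @ D @ c \<in> C \<longrightarrow>
     \<bar>real_birkhoff_sup X f (s @ E @ \<omega> @ D @ c) - real_birkhoff_sup X f s - real_birkhoff_sup X f \<omega>\<bar> \<le> \<kappa>"
proof -
  obtain V where "V \<ge> 0" and V: "\<And>\<omega> \<tau> \<tau>'. \<tau> \<in> cylinder X \<omega> \<Longrightarrow> \<tau>' \<in> cylinder X \<omega> \<Longrightarrow>
     birkhoff_sum f (length \<omega>) \<tau> \<le> birkhoff_sum f (length \<omega>) \<tau>' + V"
    using bounded_distortion[OF assms] by blast
  have "\<exists>B. \<forall>\<tau>\<in>cylinder X D. \<bar>birkhoff_sum f (length D) \<tau>\<bar> \<le> B" for D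
  proof (cases "cylinder X D = {}")
    case False
    then obtain \<tau>0 where \<tau>0: "\<tau>0 \<in> cylinder X D" by blast
    have "\<bar>birkhoff_sum f (length D) \<tau>\<bar> \<le> \<bar>birkhoff_sum f (length D) \<tau>0\<bar> + V" if "\<tau> \<in> cylinder X D" for \<tau>
      using V[OF that \<tau>0] V[OF \<tau>0 that] by linarith
    then show ?thesis by blast
  qed auto
  then obtain b where b: "\<And>D \<tau>. \<tau> \<in> cylinder X D \<Longrightarrow> \<bar>birkhoff_sum f (length D) \<tau>\<bar> \<le> b D" by metis
  define B where "B = Max (b ` insert c \<Lambda>)"
  have B: "\<bar>birkhoff_sum f (length D) \<tau>\<bar> \<le> B" if "\<tau> \<in> cylinder X D" "D \<in> insert c \<Lambda>" for D \<tau>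
    using b[OF that(1)] Max_ge[of "b ` insert c \<Lambda>" "b D"] that(2) finite_\<Lambda> by (auto simp: B_def intro: order_trans)
  have a: "\<bar>real_birkhoff_sup X f u - birkhoff_sum f (length u) \<tau>\<bar> \<le> V" if "\<tau> \<in> cylinder X u" for u \<tau>
    using birkhoff_sup_bounds(2,3)[where X = X and Y = X and \<omega> = u and \<tau> = \<tau>, OF V order_refl] that \<open>V \<ge> 0\<close> by fastforce
  show ?thesis
  \<comment> \<open>One \<open>V\<close> each for the whole word, \<open>s\<close> and
    \<open>\<omega>\<close>; one \<open>B\<close> each for \<open>E\<close>, \<open>D\<close> and
    \<open>c\<close>.\<close>
  proof (intro exI[of _ "3 * V + 3 * B"] ballI impI)
    fix s E \<omega> D assume w: "s \<in> C" "E \<in> \<Lambda>" "\<omega> \<in> C" "D \<in> \<Lambda>" "s @ E @ \<omega> @ D @ c \<in> C"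
    obtain \<tau> where \<tau>: "\<tau> \<in> cylinder X (s @ E @ \<omega> @ D @ c)" using cylinder_nonempty w by blast
    define \<tau>1 where "\<tau>1 = (shift ^^ length s) \<tau>"
    define \<tau>2 where "\<tau>2 = (shift ^^ length E) \<tau>1"
    define \<tau>3 where "\<tau>3 = (shift ^^ length \<omega>) \<tau>2"
    define \<tau>4 where "\<tau>4 = (shift ^^ length D) \<tau>3"
    note c0 = cylinder_cong[OF \<tau>, folded \<tau>1_def]
    note c1 = cylinder_cong[OF c0(2), folded \<tau>2_def]
    note c2 = cylinder_cong[OF c1(2), folded \<tau>3_def]
    note c3 = cylinder_cong[OF c2(2), folded \<tau>4_def]
    have "birkhoff_sum f (length (s @ E @ \<omega> @ D @ c)) \<tau> = birkhoff_sum f (length s) \<tau> +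
        birkhoff_sum f (length E) \<tau>1 + birkhoff_sum f (length \<omega>) \<tau>2 +
        birkhoff_sum f (length D) \<tau>3 + birkhoff_sum f (length c) \<tau>4"
      by (simp add: birkhoff_sum_add \<tau>1_def \<tau>2_def \<tau>3_def \<tau>4_def)
    with a[OF \<tau>] a[OF c0(1)] a[OF c2(1)] B[OF c1(1)] B[OF c3(1)] B[OF c3(2)] w
    show "\<bar>real_birkhoff_sup X f (s @ E @ \<omega> @ D @ c) - real_birkhoff_sup X f s - real_birkhoff_sup X f \<omega>\<bar>
        \<le> 3 * V + 3 * B"
      by simp
  qed
qed

text \<open>\<psi> may have infimum 0, but it is positive at the limit point of an increasing
  sequence of words of \<open>C\<close>; by continuity it stays above half of that value on the
  cylinder of a sufficiently long word of the sequence.\<close>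

lemma marker_word:
  assumes "Hoelder_continuous X \<psi>" "\<And>\<tau>. \<tau> \<in> X \<Longrightarrow> \<psi> \<tau> > 0" "c0 \<in> C"
  obtains c \<delta> where "c \<in> C" "\<delta> > 0" "\<And>\<tau>. \<tau> \<in> cylinder X c \<Longrightarrow> \<psi> \<tau> \<ge> \<delta>"
proof -
  \<comment> \<open>\<open>u j\<close> joins \<open>j + 1\<close> copies of \<open>c0\<close> by
    connectors; each word is a prefix of the next and the lengths are unbounded.\<close>
  define u where "u = rec_nat c0 (\<lambda>_ v. v @ glue v c0 @ c0)"
  have u0: "u 0 = c0" and uS: "u (Suc j) = u j @ glue (u j) c0 @ c0" for j
    by (simp_all add: u_def)
  have uC: "u j \<in> C" for j
    by (induction j) (auto simp: u0 uS assms(3) glue)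
  have len: "j < length (u j)" for j
  proof (induction j)
    case (Suc j)
    have "length c0 > 0" using C_nonempty[OF assms(3)] by simp
    then show ?case using Suc unfolding uS length_append by linarith
  qed (use C_nonempty[OF assms(3)] in \<open>simp add: u0\<close>)
  have pre: "prefix (u i) (u j)" if "i \<le> j" for i j
    using that by (induction j rule: dec_induct) (auto simp: uS)
  define \<tau> where "\<tau> i = u i ! i" for i
  have u_nth: "u j ! i = \<tau> i" if "i < length (u j)" for i j
  proof (cases "i \<le> j")
    case True
    then show ?thesis using pre[OF True] len[of i] by (auto simp: \<tau>_def prefix_def nth_append)
  next
    case False
    then show ?thesis using pre[of j i] that by (auto simp: \<tau>_def prefix_def nth_append)
  qed
  have "\<tau> i \<in> I \<and> A (\<tau> i) (\<tau> (Suc i)) = 1" for i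
  proof -
    have "u (Suc i) \<in> words I A" using uC C_words by blast
    then have "u (Suc i) ! i \<in> I" "A (u (Suc i) ! i) (u (Suc i) ! Suc i) = 1"
      using len[of "Suc i"] by (auto simp: words_def)
    then show ?thesis using u_nth len[of "Suc i"] by (metis Suc_lessD)
  qed
  then have \<tau>X: "\<tau> \<in> X" by (simp add: shift_space_def)
  \<comment> \<open>Half the value at \<open>\<tau>\<close>: a variation of at most
    \<open>\<delta>\<close> leaves at least \<open>\<delta>\<close>.\<close>
  define \<delta> where "\<delta> = \<psi> \<tau> / 2"
  have \<delta>: "\<delta> > 0" using assms(2)[OF \<tau>X] by (simp add: \<delta>_def)
  obtain \<alpha> V where \<alpha>: "\<alpha> > 0" and V: "V \<ge> 0"
    and hold: "\<And>\<omega> \<omega>' n. \<omega> \<in> X \<Longrightarrow> \<omega>' \<in> X \<Longrightarrow> n > 0 \<Longrightarrow>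
       \<forall>i<n. \<omega> i = \<omega>' i \<Longrightarrow> \<bar>\<psi> \<omega> - \<psi> \<omega>'\<bar> \<le> V * exp (- \<alpha> * real n)"
    using Hoelder_on_common_prefix[OF assms(1)] by metis
  \<comment> \<open>With \<open>V < m * (\<alpha> * \<delta>)\<close>, the estimate
    \<open>x \<le> exp x\<close> at \<open>x = \<alpha> * n\<close> brings the Hoelder bound below
    \<open>\<delta>\<close> for \<open>n \<ge> m\<close>.\<close>
  obtain m :: nat where m: "V / (\<alpha> * \<delta>) < real m" using reals_Archimedean2 by blast
  have small: "V * exp (- \<alpha> * real n) \<le> \<delta>" if "n \<ge> m" for n
  proof -
    have "V < real m * (\<alpha> * \<delta>)" using m \<alpha> \<delta> by (simp add: pos_divide_less_eq)
    also have "\<dots> \<le> \<delta> * (\<alpha> * real n)" using that \<alpha> \<delta> by (simp add: mult_ac)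
    also have "\<dots> \<le> \<delta> * exp (\<alpha> * real n)"
    proof (rule mult_left_mono)
      show "\<alpha> * real n \<le> exp (\<alpha> * real n)" using exp_ge_add_one_self[of "\<alpha> * real n"] by linarith
    qed (use \<delta> in simp)
    finally show ?thesis by (simp add: exp_minus field_simps)
  qed
  show ?thesis
  proof (rule that[OF uC[of m] \<delta>])
    fix \<tau>' assume \<tau>': "\<tau>' \<in> cylinder X (u m)"
    then have "\<bar>\<psi> \<tau> - \<psi> \<tau>'\<bar> \<le> V * exp (- \<alpha> * real (length (u m)))"
      using hold[OF \<tau>X, of \<tau>' "length (u m)"] u_nth[of _ m] C_nonempty[OF uC[of m]] by (auto simp: cylinder_def)
    also have "\<dots> \<le> \<delta>" using small len[of m] by simp
    finally show "\<psi> \<tau>' \<ge> \<delta>" unfolding \<delta>_def by linarith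
  qed
qed

end

section \<open>Multiplicity of concatenations\<close>

context glued_words
begin

context
  fixes \<psi> :: "(nat \<Rightarrow> nat) \<Rightarrow> real" and c :: "nat list" and \<delta> V \<eta> :: real
  assumes pos: "\<And>\<tau>. \<tau> \<in> X \<Longrightarrow> \<psi> \<tau> > 0"
    and c: "c \<in> C" and \<delta>: "\<delta> > 0" and marker: "\<And>\<tau>. \<tau> \<in> cylinder X c \<Longrightarrow> \<psi> \<tau> \<ge> \<delta>"
    and V: "\<And>\<omega> \<tau> \<tau>'. \<tau> \<in> cylinder X \<omega> \<Longrightarrow> \<tau>' \<in> cylinder X \<omega> \<Longrightarrow>
      birkhoff_sum \<psi> (length \<omega>) \<tau> \<le> birkhoff_sum \<psi> (length \<omega>) \<tau>' + V"
begin

text \<open>The counted words are prefixes of \<open>U\<close>, so their lengths tell them apart,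
  and their Birkhoff sums along \<open>\<tau>\<close> lie in an interval of length
  \<open>\<eta> + V\<close>. Cut it into cells of length \<open>\<delta>\<close>: within a cell the
  lengths differ by less than \<open>L + length c\<close>, since otherwise the longer word would
  pass the start of a marker and gain \<open>\<delta>\<close>.\<close>

lemma card_marked_prefixes_le:
  assumes L: "\<And>D. D \<in> \<Lambda> \<Longrightarrow> length D \<le> L" and F: "finite F" "F \<subseteq> window \<eta> (real_birkhoff_sup X \<psi>) C T"
    and \<tau>: "\<tau> \<in> cylinder X U"
  shows "card {\<omega>\<in>F. \<exists>D\<in>\<Lambda>. prefix (\<omega> @ D @ c) U} \<le> (nat \<lfloor>(\<eta> + V) / \<delta>\<rfloor> + 1) * (L + length c)"
proof -
  define S where "S = {\<omega>\<in>F. \<exists>D\<in>\<Lambda>. prefix (\<omega> @ D @ c) U}"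
  define N where "N = nat \<lfloor>(\<eta> + V) / \<delta>\<rfloor>"
  define t where "t \<omega> = birkhoff_sum \<psi> (length \<omega>) \<tau>" for \<omega> :: "nat list"
  \<comment> \<open>Number of the cell containing \<open>t \<omega>\<close>, counted from the lower
    end of the interval.\<close>
  define r where "r \<omega> = nat \<lfloor>(t \<omega> - (T - \<eta> - V)) / \<delta>\<rfloor>" for \<omega>
  have \<tau>X: "\<tau> \<in> X" using \<tau> by (simp add: cylinder_def)
  have finS: "finite S" using F by (simp add: S_def)
  have t: "T - \<eta> - V < t \<omega>" "t \<omega> \<le> T" if "\<omega> \<in> S" for \<omega>
  proof -
    obtain D where "prefix (\<omega> @ D @ c) U" using \<open>\<omega> \<in> S\<close> by (auto simp: S_def)
    then obtain U' where "U = \<omega> @ U'" by (auto simp: prefix_def)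
    then have cyl: "\<tau> \<in> cylinder X \<omega>" using cylinder_cong(1) \<tau> by blast
    then have "t \<omega> \<le> real_birkhoff_sup X \<psi> \<omega>" "real_birkhoff_sup X \<psi> \<omega> \<le> t \<omega> + V"
      using birkhoff_sup_bounds(2,3)[where X = X and Y = X and \<omega> = \<omega> and \<tau> = \<tau>, OF V order_refl]
      unfolding t_def by blast+
    moreover have "T - \<eta> < real_birkhoff_sup X \<psi> \<omega>" "real_birkhoff_sup X \<psi> \<omega> \<le> T"
      using that F by (auto simp: S_def window_def)
    ultimately show "T - \<eta> - V < t \<omega>" "t \<omega> \<le> T" by linarith+
  qed
  have rN: "r \<omega> \<le> N" if "\<omega> \<in> S" for \<omega>
    unfolding r_def N_def using t[OF that] \<delta> by (intro nat_mono floor_mono divide_right_mono) auto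
  have gap: "t \<omega>' \<ge> t \<omega> + \<delta>" if "\<omega> \<in> S" "\<omega>' \<in> S" "length \<omega> + (L + length c) \<le> length \<omega>'" for \<omega> \<omega>'
  proof -
    obtain D where D: "D \<in> \<Lambda>" "prefix (\<omega> @ D @ c) U" using \<open>\<omega> \<in> S\<close> by (auto simp: S_def)
    then obtain U' where U': "U = \<omega> @ D @ c @ U'" by (auto simp: prefix_def)
    define \<tau>1 where "\<tau>1 = (shift ^^ length \<omega>) \<tau>"
    have "\<tau>1 \<in> cylinder X (D @ c @ U')" using cylinder_cong(2) \<tau> unfolding U' \<tau>1_def by blast
    then have "(shift ^^ length D) \<tau>1 \<in> cylinder X c" using cylinder_cong by blast
    then have "\<delta> \<le> \<psi> ((shift ^^ length D) \<tau>1)" by (rule marker)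
    \<comment> \<open>The marker starts \<open>length D \<le> L\<close> letters after the end of
      \<open>\<omega>\<close>, hence before the end of \<open>\<omega>'\<close>. The summand at that
      position alone yields \<open>\<delta>\<close>; the others are nonnegative.\<close>
    also have "\<dots> \<le> birkhoff_sum \<psi> (length \<omega>' - length \<omega>) \<tau>1"
      unfolding birkhoff_sum_def
    proof (rule member_le_sum)
      have "length c > 0" using C_nonempty[OF c] by simp
      then show "length D \<in> {..<length \<omega>' - length \<omega>}" using L[OF D(1)] that(3) unfolding lessThan_iff by linarith
      show "0 \<le> \<psi> ((shift ^^ k) \<tau>1)" for k
        using pos funpow_shift_in_shift_space[OF funpow_shift_in_shift_space[OF \<tau>X]]
        unfolding \<tau>1_def by (meson less_imp_le)
    qed simp
    finally have "t \<omega> + \<delta> \<le> birkhoff_sum \<psi> (length \<omega> + (length \<omega>' - length \<omega>)) \<tau>"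
      unfolding birkhoff_sum_add t_def \<tau>1_def by simp
    also have "length \<omega> + (length \<omega>' - length \<omega>) = length \<omega>'" using that(3) by simp
    finally show ?thesis by (simp add: t_def)
  qed
  have fibre: "card {\<omega>\<in>S. r \<omega> = j} \<le> L + length c" for j
  proof (cases "{\<omega>\<in>S. r \<omega> = j} = {}")
    case False
    then obtain \<omega>0 where \<omega>0: "\<omega>0 \<in> S" "r \<omega>0 = j" "\<And>\<omega>. \<omega> \<in> S \<Longrightarrow> r \<omega> = j \<Longrightarrow> length \<omega>0 \<le> length \<omega>"
      using ex_has_least_nat[of "\<lambda>\<omega>. \<omega> \<in> S \<and> r \<omega> = j" _ length] by blast
    have "length \<omega> < length \<omega>0 + (L + length c)" if "\<omega> \<in> S" "r \<omega> = j" for \<omega>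
    proof (rule ccontr)
      assume "\<not> ?thesis"
      then have "t \<omega>0 + \<delta> \<le> t \<omega>" using gap \<omega>0 that by simp
      then have "(t \<omega>0 - (T - \<eta> - V)) / \<delta> + 1 \<le> (t \<omega> - (T - \<eta> - V)) / \<delta>"
        using \<delta> by (simp add: divide_simps)
      then have "\<lfloor>(t \<omega>0 - (T - \<eta> - V)) / \<delta>\<rfloor> + 1 \<le> \<lfloor>(t \<omega> - (T - \<eta> - V)) / \<delta>\<rfloor>"
        by linarith
      \<comment> \<open>Nonnegativity keeps \<open>nat\<close> from merging distinct floors.\<close>
      moreover have "(t \<omega>0 - (T - \<eta> - V)) / \<delta> \<ge> 0" using t[OF \<omega>0(1)] \<delta> by simp
      ultimately show False using \<omega>0(2) that(2) unfolding r_def by linarith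
    qed
    then have "length ` {\<omega>\<in>S. r \<omega> = j} \<subseteq> {length \<omega>0 ..< length \<omega>0 + (L + length c)}"
      using \<omega>0 by auto
    from card_mono[OF _ this] have "card (length ` {\<omega>\<in>S. r \<omega> = j}) \<le> L + length c"
      by simp
    moreover have "inj_on length {\<omega>\<in>S. r \<omega> = j}"
    proof (rule inj_on_inverseI)
      show "take (length \<omega>) U = \<omega>" if "\<omega> \<in> {\<omega>\<in>S. r \<omega> = j}" for \<omega>
        using that by (auto simp: S_def prefix_def)
    qed
    ultimately show ?thesis by (simp add: card_image)
  next
    case True
    then show ?thesis by (simp only: card.empty)
  qed
  have "card S \<le> card (\<Union>j\<le>N. {\<omega>\<in>S. r \<omega> = j})"
    using rN finS by (intro card_mono) auto
  also have "\<dots> \<le> (\<Sum>j\<le>N. card {\<omega>\<in>S. r \<omega> = j})" by (rule card_UN_le) simp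
  also have "\<dots> \<le> (\<Sum>j\<le>N. L + length c)" by (rule sum_mono) (rule fibre)
  finally show ?thesis by (simp add: S_def N_def)
qed

text \<open>In \<open>W\<close> the factor \<open>\<omega>\<close> starts after \<open>s\<close> and
  a connector of length at most \<open>L\<close>. This leaves \<open>L + 1\<close> starting points,
  and for each of them the count for marked prefixes applies to the rest of
  \<open>W\<close>.\<close>

lemma card_glued_prefixes_le:
  assumes L: "\<And>D. D \<in> \<Lambda> \<Longrightarrow> length D \<le> L" and F: "finite F" "F \<subseteq> window \<eta> (real_birkhoff_sup X \<psi>) C T"
    and "cylinder X W \<noteq> {}"
  shows "card {\<omega>\<in>F. \<exists>E\<in>\<Lambda>. \<exists>D\<in>\<Lambda>. prefix (s @ E @ \<omega> @ D @ c) W}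
    \<le> (L + 1) * ((nat \<lfloor>(\<eta> + V) / \<delta>\<rfloor> + 1) * (L + length c))"
proof -
  let ?M = "(nat \<lfloor>(\<eta> + V) / \<delta>\<rfloor> + 1) * (L + length c)"
  define S where "S e = {\<omega>\<in>F. \<exists>D\<in>\<Lambda>. prefix (\<omega> @ D @ c) (drop (length s + e) W)}" for e
  obtain \<tau> where "\<tau> \<in> cylinder X W" using assms by blast
  \<comment> \<open>The shift is by \<open>length (take k W)\<close> because \<open>k\<close> may
    exceed the length of \<open>W\<close>.\<close>
  then have \<tau>: "(shift ^^ length (take k W)) \<tau> \<in> cylinder X (drop k W)" for k
    using cylinder_cong(2)[of \<tau> I A "take k W" "drop k W"] by (simp del: length_take)
  have "{\<omega>\<in>F. \<exists>E\<in>\<Lambda>. \<exists>D\<in>\<Lambda>. prefix (s @ E @ \<omega> @ D @ c) W} \<subseteq> (\<Union>e\<le>L. S e)"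
    using L by (fastforce simp: S_def prefix_def)
  then have "card {\<omega>\<in>F. \<exists>E\<in>\<Lambda>. \<exists>D\<in>\<Lambda>. prefix (s @ E @ \<omega> @ D @ c) W} \<le> card (\<Union>e\<le>L. S e)"
    using F by (intro card_mono) (auto simp: S_def)
  also have "\<dots> \<le> (\<Sum>e\<le>L. card (S e))" by (rule card_UN_le) simp
  also have "\<dots> \<le> (\<Sum>e\<le>L. ?M)"
    unfolding S_def by (intro sum_mono card_marked_prefixes_le[OF L F \<tau>])
  finally show ?thesis by simp
qed

end

section \<open>Heavy families of words over a finite alphabet\<close>

text \<open>The bound \<open>n\<close> precedes \<open>R\<close> and \<open>B\<close>: it depends
  only on one finite family \<open>F\<close>, the connectors and the marker, whereas longer
  concatenations of these same pieces raise both the total weight and the \<psi>-values without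
  limit.\<close>

lemma heavy_finite_alphabet:
  assumes \<phi>: "Hoelder_continuous X \<phi>" and \<psi>: "Hoelder_continuous X \<psi>" and pos: "\<And>\<tau>. \<tau> \<in> X \<Longrightarrow> \<psi> \<tau> > 0"
    and p: "ereal p < growth_rate \<eta> (real_birkhoff_sup X \<psi>) (real_birkhoff_sup X \<phi>) C"
  shows "\<exists>n. \<forall>R B. \<exists>\<W>. finite \<W> \<and> \<W> \<subseteq> {W\<in>C. set W \<subseteq> {..n} \<and> R \<le> real_birkhoff_sup X \<psi> W} \<and>
    B \<le> (\<Sum>W\<in>\<W>. exp (real_birkhoff_sup X \<phi> W - p * real_birkhoff_sup X \<psi> W))"
proof -
  define a where "a = real_birkhoff_sup X \<psi>"
  define b where "b = real_birkhoff_sup X \<phi>"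
  define h where "h W = b W - p * a W" for W
  \<comment> \<open>The gap between \<open>p\<close> and \<open>q\<close> will pay for
    multiplicities and for the errors at the joints.\<close>
  obtain q where q: "p < q" "ereal q < growth_rate \<eta> a b C"
    using ereal_dense2[OF p] unfolding a_def b_def by auto
  obtain T\<^sub>0 F\<^sub>0 where "F\<^sub>0 \<subseteq> window \<eta> a C T\<^sub>0" "exp (q * T\<^sub>0) < (\<Sum>\<omega>\<in>F\<^sub>0. exp (b \<omega>))"
    using less_growth_rate_imp[OF q(2), of 0] by blast
  then have "F\<^sub>0 \<noteq> {}" by (auto simp: not_less)
  then obtain c0 where "c0 \<in> C"
    using \<open>F\<^sub>0 \<subseteq> window \<eta> a C T\<^sub>0\<close> by (auto simp: window_def)
  obtain c \<delta> where c: "c \<in> C" and \<delta>: "\<delta> > 0" and marker: "\<And>\<tau>. \<tau> \<in> cylinder X c \<Longrightarrow> \<psi> \<tau> \<ge> \<delta>"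
    by (rule marker_word[OF \<psi> pos \<open>c0 \<in> C\<close>]) (assumption, (rule that; blast))
  obtain V where V: "\<And>\<omega> \<tau> \<tau>'. \<tau> \<in> cylinder X \<omega> \<Longrightarrow> \<tau>' \<in> cylinder X \<omega> \<Longrightarrow>
      birkhoff_sum \<psi> (length \<omega>) \<tau> \<le> birkhoff_sum \<psi> (length \<omega>) \<tau>' + V"
    by (rule bounded_distortion[OF \<psi>]) (rule that; blast)
  obtain \<kappa>a where \<kappa>a: "\<forall>s\<in>C. \<forall>E\<in>\<Lambda>. \<forall>\<omega>\<in>C. \<forall>D\<in>\<Lambda>. s @ E @ \<omega> @ D @ c \<in> C \<longrightarrow>
     \<bar>a (s @ E @ \<omega> @ D @ c) - a s - a \<omega>\<bar> \<le> \<kappa>a"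
    using quasi_additive[OF \<psi>, of c] unfolding a_def by (elim exE)
  obtain \<kappa>b where \<kappa>b: "\<forall>s\<in>C. \<forall>E\<in>\<Lambda>. \<forall>\<omega>\<in>C. \<forall>D\<in>\<Lambda>. s @ E @ \<omega> @ D @ c \<in> C \<longrightarrow>
     \<bar>b (s @ E @ \<omega> @ D @ c) - b s - b \<omega>\<bar> \<le> \<kappa>b"
    using quasi_additive[OF \<phi>, of c] unfolding b_def by (elim exE)
  \<comment> \<open>Bounds the loss in \<open>h\<close> when one factor is attached.\<close>
  define \<kappa> where "\<kappa> = \<kappa>b + \<bar>p\<bar> * \<kappa>a"
  define L where "L = Max (insert 0 (length ` \<Lambda>))"
  have L: "length D \<le> L" if "D \<in> \<Lambda>" for D
    unfolding L_def using that finite_\<Lambda> by (intro Max_ge) auto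
  \<comment> \<open>This multiplicity bound does not involve \<open>T\<close>, so \<open>T\<close>
    can be chosen afterwards to beat it.\<close>
  define M where "M = (L + 1) * ((nat \<lfloor>(\<eta> + V) / \<delta>\<rfloor> + 1) * (L + length c))"
  have "M > 0" using C_nonempty[OF c] by (simp add: M_def)
  \<comment> \<open>The first entry makes every step raise \<open>a\<close> by at least 1; the
    second makes the weight of \<open>F\<close>, after the loss \<open>\<kappa>\<close>, at least
    \<open>2 * M\<close>.\<close>
  define T0 where "T0 = max (\<eta> + \<kappa>a + 1) ((\<bar>p\<bar> * \<bar>\<eta>\<bar> + \<kappa> + ln (2 * real M)) / (q - p))"
  obtain T F where "T \<ge> T0" and F: "finite F" "F \<subseteq> window \<eta> a C T" "exp (q * T) < (\<Sum>\<omega>\<in>F. exp (b \<omega>))"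
    using less_growth_rate_imp[OF q(2)] by blast
  have FC: "\<omega> \<in> C" "T - \<eta> < a \<omega>" "a \<omega> \<le> T" if "\<omega> \<in> F" for \<omega>
    using that F(2) by (auto simp: window_def)
  have "(\<bar>p\<bar> * \<bar>\<eta>\<bar> + \<kappa> + ln (2 * real M)) / (q - p) \<le> T" using \<open>T \<ge> T0\<close> by (simp add: T0_def)
  then have "\<bar>p\<bar> * \<bar>\<eta>\<bar> + \<kappa> + ln (2 * real M) \<le> (q - p) * T"
    using q by (simp add: pos_divide_le_eq mult.commute)
  then have "ln (2 * real M) \<le> q * T + (- p * T - \<bar>p\<bar> * \<bar>\<eta>\<bar> - \<kappa>)"
    by (simp add: algebra_simps)
  then have "exp (ln (2 * real M)) \<le> exp (q * T + (- p * T - \<bar>p\<bar> * \<bar>\<eta>\<bar> - \<kappa>))"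
    by (simp only: exp_le_cancel_iff)
  then have "2 * real M \<le> exp (q * T) * exp (- p * T - \<bar>p\<bar> * \<bar>\<eta>\<bar> - \<kappa>)"
    using \<open>M > 0\<close> by (simp only: exp_add) simp
  also have "\<dots> \<le> (\<Sum>\<omega>\<in>F. exp (b \<omega>)) * exp (- p * T - \<bar>p\<bar> * \<bar>\<eta>\<bar> - \<kappa>)"
    using F by (intro mult_right_mono) auto
  also have "\<dots> \<le> (\<Sum>\<omega>\<in>F. exp (h \<omega> - \<kappa>))"
    unfolding sum_distrib_right
  proof (rule sum_mono)
    fix \<omega> assume "\<omega> \<in> F"
    then have "\<bar>p * (a \<omega> - T)\<bar> \<le> \<bar>p\<bar> * \<bar>\<eta>\<bar>"
      unfolding abs_mult using FC[of \<omega>] by (intro mult_left_mono) auto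
    from abs_le_D1[OF this] have "b \<omega> + (- p * T - \<bar>p\<bar> * \<bar>\<eta>\<bar> - \<kappa>) \<le> h \<omega> - \<kappa>"
      by (simp add: h_def right_diff_distrib)
    then show "exp (b \<omega>) * exp (- p * T - \<bar>p\<bar> * \<bar>\<eta>\<bar> - \<kappa>) \<le> exp (h \<omega> - \<kappa>)"
      by (simp only: exp_add[symmetric] exp_le_cancel_iff)
  qed
  finally have large: "2 * real M \<le> (\<Sum>\<omega>\<in>F. exp (h \<omega> - \<kappa>))" .
  define E where "E s \<omega> = glue s \<omega>" for s \<omega>
  define D where "D s \<omega> = glue (s @ E s \<omega> @ \<omega>) c" for s \<omega>
  \<comment> \<open>Each factor from \<open>F\<close> is followed by a connector and the marker, as
    the multiplicity bound demands.\<close>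
  define step where "step s \<omega> = s @ E s \<omega> @ \<omega> @ D s \<omega> @ c" for s \<omega>
  have \<Lambda>: "E s \<omega> \<in> \<Lambda>" "D s \<omega> \<in> \<Lambda>" and stepC: "step s \<omega> \<in> C" if "s \<in> C" "\<omega> \<in> F" for s \<omega>
    using glue[of s \<omega>] glue[of "s @ E s \<omega> @ \<omega>" c] glue_in c that FC by (auto simp: E_def D_def step_def)
  have step_ab: "\<bar>a (step s \<omega>) - a s - a \<omega>\<bar> \<le> \<kappa>a" "\<bar>b (step s \<omega>) - b s - b \<omega>\<bar> \<le> \<kappa>b"
    if "s \<in> C" "\<omega> \<in> F" for s \<omega>
    using stepC[OF that] \<kappa>a[rule_format, OF that(1) \<Lambda>(1)[OF that] FC(1)[OF that(2)] \<Lambda>(2)[OF that]]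
      \<kappa>b[rule_format, OF that(1) \<Lambda>(1)[OF that] FC(1)[OF that(2)] \<Lambda>(2)[OF that]]
    unfolding step_def by simp_all
  have step_a: "a (step s \<omega>) \<ge> a s + 1" if "s \<in> C" "\<omega> \<in> F" for s \<omega>
  proof -
    have "\<bar>a (step s \<omega>) - a s - a \<omega>\<bar> \<le> \<kappa>a" by (rule step_ab[OF that])
    moreover have "T \<ge> \<eta> + \<kappa>a + 1" using \<open>T \<ge> T0\<close> by (simp add: T0_def)
    ultimately show ?thesis using FC[OF that(2)] by linarith
  qed
  have step_h: "h (step s \<omega>) \<ge> h s + (h \<omega> - \<kappa>)" if "s \<in> C" "\<omega> \<in> F" for s \<omega>
  proof -
    note step_ab[OF that]
    moreover from this(1) have "\<bar>p * (a (step s \<omega>) - a s - a \<omega>)\<bar> \<le> \<bar>p\<bar> * \<kappa>a"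
      unfolding abs_mult by (intro mult_left_mono) auto
    from abs_le_D1[OF this] have "p * a (step s \<omega>) - p * a s - p * a \<omega> \<le> \<bar>p\<bar> * \<kappa>a"
      by (simp add: right_diff_distrib)
    ultimately show ?thesis unfolding h_def \<kappa>_def by linarith
  qed
  have card: "card {\<omega>\<in>F. prefix (step s \<omega>) W} \<le> M" if "s \<in> C" "W \<in> C" for s W
  proof -
    have "card {\<omega>\<in>F. prefix (step s \<omega>) W} \<le> card {\<omega>\<in>F. \<exists>E\<in>\<Lambda>. \<exists>D\<in>\<Lambda>. prefix (s @ E @ \<omega> @ D @ c) W}"
      using F(1) \<Lambda>[OF that(1)] by (intro card_mono) (auto simp: step_def)
    also have "\<dots> \<le> M" unfolding M_def
      by (rule card_glued_prefixes_le[OF pos c \<delta> marker V L F(1) F(2)[unfolded a_def]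
            cylinder_nonempty[OF that(2)]])
    finally show ?thesis .
  qed
  define J where "J = set c \<union> \<Union> (set ` \<Lambda>) \<union> \<Union> (set ` F)"
  define n where "n = Max (insert 0 J)"
  have "finite J" using finite_\<Lambda> F by (simp add: J_def)
  then have J: "J \<subseteq> {..n}" unfolding n_def by (auto intro: Max_ge)
  have "\<exists>\<W>. finite \<W> \<and> \<W> \<subseteq> {W\<in>C. set W \<subseteq> {..n} \<and> R \<le> a W} \<and> B \<le> (\<Sum>W\<in>\<W>. exp (h W))" for R B
  proof -
    \<comment> \<open>\<open>k1\<close> steps lift \<open>a\<close> from \<open>a c\<close> to at
      least \<open>R\<close>; \<open>k2\<close> doublings lift the weight from
      \<open>exp (h c)\<close> above \<open>B\<close>.\<close>
    obtain k1 :: nat where k1: "R - a c \<le> real k1" using real_arch_simple by blast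
    obtain k2 :: nat where k2: "B / exp (h c) < 2 ^ k2" using real_arch_pow[of 2] by auto
    define k where "k = max k1 k2"
    define \<W> where "\<W> = foldl step c ` lists_over F k"
    have "finite \<W>" using F by (simp add: \<W>_def finite_lists_over)
    moreover have "foldl step c ws \<in> C \<and> set (foldl step c ws) \<subseteq> {..n}" if "ws \<in> lists_over F k" for ws
    proof (rule foldl_invariant[where P = "\<lambda>s. s \<in> C \<and> set s \<subseteq> {..n}" and F = F])
      show "step s \<omega> \<in> C \<and> set (step s \<omega>) \<subseteq> {..n}" if "s \<in> C \<and> set s \<subseteq> {..n}" "\<omega> \<in> F" for s \<omega>
      proof -
        have "set (E s \<omega>) \<subseteq> J" "set (D s \<omega>) \<subseteq> J" "set \<omega> \<subseteq> J" "set c \<subseteq> J"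
          using \<Lambda> that by (auto simp: J_def)
        then show ?thesis using that stepC J by (auto simp: step_def)
      qed
      show "c \<in> C \<and> set c \<subseteq> {..n}" using c J by (auto simp: J_def)
      show "set ws \<subseteq> F" using that by (simp add: lists_over_def)
    qed
    moreover have "a (foldl step s ws) \<ge> a s + real (length ws)" if "s \<in> C" "set ws \<subseteq> F" for s ws
      using that
    proof (induction ws arbitrary: s)
      case (Cons \<omega> ws)
      then have "a (foldl step (step s \<omega>) ws) \<ge> a (step s \<omega>) + real (length ws)" using stepC by auto
      then show ?case using step_a[of s \<omega>] Cons.prems by simp
    qed simp
    then have "R \<le> a (foldl step c ws)" if "ws \<in> lists_over F k" for ws
      using that c k1 unfolding lists_over_def k_def by fastforce
    moreover have "exp (h c) * 2 ^ k \<le> (\<Sum>W\<in>\<W>. exp (h W))"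
      unfolding \<W>_def
      by (rule sum_exp_foldl_image_ge[where C = C and M = M and g = "\<lambda>\<omega>. h \<omega> - \<kappa>"])
        (use F stepC card step_h c \<open>M > 0\<close> large in \<open>auto simp: step_def\<close>)
    moreover have "B \<le> exp (h c) * 2 ^ k"
    proof -
      have "B < 2 ^ k2 * exp (h c)" using k2 by (simp add: pos_divide_less_eq)
      also have "\<dots> \<le> exp (h c) * 2 ^ k" by (simp add: k_def power_increasing mult.commute)
      finally show ?thesis by simp
    qed
    ultimately show ?thesis by (intro exI[of _ \<W>]) (auto simp: \<W>_def)
  qed
  then show ?thesis by (auto simp: a_def b_def h_def)
qed

section \<open>Convergence of the pressures of the subsystems\<close>

text \<open>On words whose cylinders meet \<open>K n\<close>, suprema over \<open>K n\<close> and
  over the full shift differ by at most a distortion constant. Hence the subsystem pressures stay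
  below the full one, and families that are heavy for the full shift remain heavy on all large
  \<open>K n\<close>.\<close>

lemma exhausting:
  assumes "\<eta> > 0" and \<phi>: "Hoelder_continuous X \<phi>" and \<psi>: "Hoelder_continuous X \<psi>"
    and pos: "\<And>\<tau>. \<tau> \<in> X \<Longrightarrow> \<psi> \<tau> > 0"
  shows "exhausting_principle I A \<eta> \<psi> \<phi> C"
proof -
  define K where "K = bounded_letters X"
  define Cn where "Cn n = C \<inter> words_of I A (K n)" for n
  obtain V where V0: "V \<ge> 0" and V: "\<And>\<omega> \<tau> \<tau>'. \<tau> \<in> cylinder X \<omega> \<Longrightarrow> \<tau>' \<in> cylinder X \<omega> \<Longrightarrow>
      birkhoff_sum \<psi> (length \<omega>) \<tau> \<le> birkhoff_sum \<psi> (length \<omega>) \<tau>' + V"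
    by (rule bounded_distortion[OF \<psi>]) (rule that; blast)
  obtain W where W0: "W \<ge> 0" and W: "\<And>\<omega> \<tau> \<tau>'. \<tau> \<in> cylinder X \<omega> \<Longrightarrow> \<tau>' \<in> cylinder X \<omega> \<Longrightarrow>
      birkhoff_sum \<phi> (length \<omega>) \<tau> \<le> birkhoff_sum \<phi> (length \<omega>) \<tau>' + W"
    by (rule bounded_distortion[OF \<phi>]) (rule that; blast)
  have KX: "K n \<subseteq> X" for n by (auto simp: K_def bounded_letters_def)
  have ne: "cylinder (K n) \<omega> \<noteq> {}" if "\<omega> \<in> Cn n" for n \<omega>
    using that KX[of n] by (auto simp: Cn_def words_of_def cylinder_def)
  note fin_\<psi> = birkhoff_sup_bounds(1)[where f = \<psi>, OF V]
    and fin_\<phi> = birkhoff_sup_bounds(1)[where f = \<phi>, OF W]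
  have P: "induced_pressure \<eta> X \<psi> \<phi> C = growth_rate \<eta> (real_birkhoff_sup X \<psi>) (real_birkhoff_sup X \<phi>) C"
    by (intro induced_pressure_eq_growth_rate fin_\<psi> fin_\<phi>) (use cylinder_nonempty in auto)
  have Pn: "induced_pressure \<eta> (K n) \<psi> \<phi> (Cn n) =
      growth_rate \<eta> (real_birkhoff_sup (K n) \<psi>) (real_birkhoff_sup (K n) \<phi>) (Cn n)" for n
    by (intro induced_pressure_eq_growth_rate fin_\<psi> fin_\<phi>) (use ne KX in auto)
  have between: "real_birkhoff_sup (K n) f \<omega> \<le> real_birkhoff_sup X f \<omega>"
      "real_birkhoff_sup X f \<omega> \<le> real_birkhoff_sup (K n) f \<omega> + U"
    if "\<omega> \<in> Cn n" and U: "\<And>\<omega> \<tau> \<tau>'. \<tau> \<in> cylinder X \<omega> \<Longrightarrow> \<tau>' \<in> cylinder X \<omega> \<Longrightarrow>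
      birkhoff_sum f (length \<omega>) \<tau> \<le> birkhoff_sum f (length \<omega>) \<tau>' + U" for f U n \<omega>
  proof -
    have neX: "cylinder X \<omega> \<noteq> {}" using that cylinder_nonempty by (auto simp: Cn_def)
    have neK: "cylinder (K n) \<omega> \<noteq> {}" by (rule ne[OF that(1)])
    then obtain \<tau> where \<tau>: "\<tau> \<in> cylinder (K n) \<omega>" by blast
    then have \<tau>X: "\<tau> \<in> cylinder X \<omega>" using KX by (auto simp: cylinder_def)
    have "real_birkhoff_sup X f \<omega> \<le> birkhoff_sum f (length \<omega>) \<tau> + U"
      by (rule birkhoff_sup_bounds(3)[OF U order_refl neX \<tau>X])
    also have "birkhoff_sum f (length \<omega>) \<tau> \<le> real_birkhoff_sup (K n) f \<omega>"
      by (rule birkhoff_sup_bounds(2)[OF U KX neK \<tau>])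
    finally show "real_birkhoff_sup X f \<omega> \<le> real_birkhoff_sup (K n) f \<omega> + U" by simp
    show "real_birkhoff_sup (K n) f \<omega> \<le> real_birkhoff_sup X f \<omega>"
      by (rule real_birkhoff_sup_mono[OF KX birkhoff_sup_bounds(1)[OF U KX neK]
            birkhoff_sup_bounds(1)[OF U order_refl neX]])
  qed
  have upper: "induced_pressure \<eta> (K n) \<psi> \<phi> (Cn n) \<le> induced_pressure \<eta> X \<psi> \<phi> C" for n
    unfolding P Pn
  proof (rule growth_rate_mono)
    fix \<omega> assume \<omega>: "\<omega> \<in> Cn n"
    show "real_birkhoff_sup (K n) \<psi> \<omega> \<le> real_birkhoff_sup X \<psi> \<omega>"
      by (rule between(1)[OF \<omega> V])
    show "real_birkhoff_sup X \<psi> \<omega> \<le> real_birkhoff_sup (K n) \<psi> \<omega> + V"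
      by (rule between(2)[OF \<omega> V])
    show "real_birkhoff_sup (K n) \<phi> \<omega> \<le> real_birkhoff_sup X \<phi> \<omega>"
      by (rule between(1)[OF \<omega> W])
  qed (use \<open>\<eta> > 0\<close> in \<open>auto simp: Cn_def\<close>)
  have lower: "\<forall>\<^sub>F n in sequentially. y < induced_pressure \<eta> (K n) \<psi> \<phi> (Cn n)"
    if y: "y < induced_pressure \<eta> X \<psi> \<phi> C" for y
  proof -
    obtain p where p: "y < ereal p" "ereal p < induced_pressure \<eta> X \<psi> \<phi> C"
      using ereal_dense2[OF y] by blast
    obtain n0 where n0: "\<And>R B. \<exists>\<W>. finite \<W> \<and> \<W> \<subseteq> {w\<in>C. set w \<subseteq> {..n0} \<and> R \<le> real_birkhoff_sup X \<psi> w} \<and>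
        B \<le> (\<Sum>w\<in>\<W>. exp (real_birkhoff_sup X \<phi> w - p * real_birkhoff_sup X \<psi> w))"
      using heavy_finite_alphabet[OF \<phi> \<psi> pos p(2)[unfolded P]] by blast
    \<comment> \<open>Connectors count too, since the periodic points that place a word in
      \<open>K n\<close> run through them.\<close>
    define n1 where "n1 = Max (insert n0 (\<Union> (set ` \<Lambda>)))"
    have n1: "n0 \<le> n1" "\<And>D. D \<in> \<Lambda> \<Longrightarrow> set D \<subseteq> {..n1}"
      using finite_\<Lambda> by (auto simp: n1_def intro!: Max_ge)
    have "ereal p \<le> induced_pressure \<eta> (K n) \<psi> \<phi> (Cn n)" if "n \<ge> n1" for n
      unfolding Pn
    proof (rule growth_rate_ge[OF \<open>\<eta> > 0\<close>])
      fix R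
      \<comment> \<open>Passing to suprema over \<open>K n\<close> lowers the \<psi>-value by at
        most \<open>V\<close> and the exponent by at most \<open>W + \<bar>p\<bar> * V\<close>; the
        surplus demanded here leaves \<open>R\<close> and 1.\<close>
      obtain \<W> where \<W>: "finite \<W>" "\<W> \<subseteq> {w\<in>C. set w \<subseteq> {..n0} \<and> R + V \<le> real_birkhoff_sup X \<psi> w}"
        "exp (W + \<bar>p\<bar> * V) \<le> (\<Sum>w\<in>\<W>. exp (real_birkhoff_sup X \<phi> w - p * real_birkhoff_sup X \<psi> w))"
        using n0[where R = "R + V" and B = "exp (W + \<bar>p\<bar> * V)"] by (elim exE conjE)
      have n: "{..n0} \<subseteq> {..n}" "{..n1} \<subseteq> {..n}" using n1(1) \<open>n \<ge> n1\<close> by auto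
      have sub: "\<W> \<subseteq> Cn n"
      proof
        fix w assume "w \<in> \<W>"
        then have "w \<in> C" "set w \<subseteq> {..n0}" using \<W>(2) by auto
        then have w: "w \<in> C" "set w \<subseteq> {..n}" using n(1) by (blast intro: order_trans)+
        have "cylinder (K n) w \<noteq> {}" unfolding K_def
          by (rule cylinder_bounded_letters_nonempty[OF w]) (rule order_trans[OF n1(2) n(2)])
        then have "cylinder X w \<inter> K n \<noteq> {}" using KX by (auto simp: cylinder_def)
        then show "w \<in> Cn n" using w C_words by (auto simp: Cn_def words_of_def)
      qed
      have "exp (W + \<bar>p\<bar> * V) \<le>
          (\<Sum>w\<in>\<W>. exp (real_birkhoff_sup (K n) \<phi> w - p * real_birkhoff_sup (K n) \<psi> w) * exp (W + \<bar>p\<bar> * V))"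
      proof (rule order_trans[OF \<W>(3)], rule sum_mono)
        fix w assume "w \<in> \<W>"
        then have w: "w \<in> Cn n" using sub by blast
        have "\<bar>p * (real_birkhoff_sup (K n) \<psi> w - real_birkhoff_sup X \<psi> w)\<bar> \<le> \<bar>p\<bar> * V"
          unfolding abs_mult using between[OF w V] V0 by (intro mult_left_mono) auto
        from abs_le_D1[OF this] have "p * real_birkhoff_sup (K n) \<psi> w - p * real_birkhoff_sup X \<psi> w \<le> \<bar>p\<bar> * V"
          by (simp add: right_diff_distrib)
        then have "real_birkhoff_sup X \<phi> w - p * real_birkhoff_sup X \<psi> w \<le>
            real_birkhoff_sup (K n) \<phi> w - p * real_birkhoff_sup (K n) \<psi> w + (W + \<bar>p\<bar> * V)"
          using between(2)[OF w W] by linarith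
        then show "exp (real_birkhoff_sup X \<phi> w - p * real_birkhoff_sup X \<psi> w) \<le>
            exp (real_birkhoff_sup (K n) \<phi> w - p * real_birkhoff_sup (K n) \<psi> w) * exp (W + \<bar>p\<bar> * V)"
          by (simp only: exp_add[symmetric] exp_le_cancel_iff)
      qed
      then have "1 \<le> (\<Sum>w\<in>\<W>. exp (real_birkhoff_sup (K n) \<phi> w - p * real_birkhoff_sup (K n) \<psi> w))"
        unfolding sum_distrib_right[symmetric] by simp
      moreover have "R \<le> real_birkhoff_sup (K n) \<psi> w" if "w \<in> \<W>" for w
        using between(2)[OF subsetD[OF sub that] V] that \<W>(2) by fastforce
      ultimately show "\<exists>F. finite F \<and> F \<subseteq> {w \<in> Cn n. R \<le> real_birkhoff_sup (K n) \<psi> w} \<and>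
          1 \<le> (\<Sum>w\<in>F. exp (real_birkhoff_sup (K n) \<phi> w - p * real_birkhoff_sup (K n) \<psi> w))"
        using \<W>(1) sub by (intro exI[of _ \<W>]) auto
    qed
    then show ?thesis
      using p(1) unfolding eventually_sequentially by (meson less_le_trans)
  qed
  have "(\<lambda>n. induced_pressure \<eta> (K n) \<psi> \<phi> (Cn n)) \<longlonglongrightarrow> induced_pressure \<eta> X \<psi> \<phi> C"
  proof (rule order_tendstoI)
    fix y assume "induced_pressure \<eta> X \<psi> \<phi> C < y"
    then show "\<forall>\<^sub>F n in sequentially. induced_pressure \<eta> (K n) \<psi> \<phi> (Cn n) < y"
      by (intro always_eventually allI le_less_trans[OF upper])
  qed (rule lower)
  moreover have "compactin (shift_topology I A) (K n)" "shift ` K n \<subseteq> K n" for n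
    unfolding K_def by (rule compactin_bounded_letters, rule shift_bounded_letters)
  ultimately show ?thesis
    unfolding exhausting_principle_def Cn_def using KX by blast
qed

end

theorem corollary3p13:
  fixes I :: "nat set" and A :: "nat \<Rightarrow> nat \<Rightarrow> nat" and \<eta> :: real
    and \<phi> \<psi> :: "(nat \<Rightarrow> nat) \<Rightarrow> real" and C :: "nat list set"
  assumes "\<forall>i\<in>I. \<forall>j\<in>I. A i j \<in> {0, 1}"
    and "\<eta> > 0"
    and "Hoelder_continuous (shift_space I A) \<phi>"
    and "Hoelder_continuous (shift_space I A) \<psi>"
    and "\<forall>\<omega>\<in>shift_space I A. \<psi> \<omega> > 0"
    and "C \<subseteq> words I A"
    and "finitely_irreducible I A C"
    and "loop_representable I A C"
  shows "exhausting_principle I A \<eta> \<psi> \<phi> C"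
proof -
  obtain \<Lambda> where \<Lambda>: "finite \<Lambda>" "\<forall>u\<in>C. \<forall>v\<in>C. \<exists>D\<in>\<Lambda> \<union> {[]}. u @ D @ v \<in> C"
    using assms(7) unfolding finitely_irreducible_def by blast
  \<comment> \<open>The connector becomes a function of the pair of words; the empty word counts as
    a connector.\<close>
  then obtain glue where "\<And>u v. u \<in> C \<Longrightarrow> v \<in> C \<Longrightarrow> glue u v \<in> \<Lambda> \<union> {[]} \<and> u @ glue u v @ v \<in> C"
    by metis
  then interpret glued_words I A C "\<Lambda> \<union> {[]}" glue
    using assms(6) \<Lambda>(1) by unfold_locales auto
  show ?thesis using exhausting assms by blast
qed

end
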